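(* Let $\lambda > 0$ and let $X = \{X_i\}_{i \ge 1}$ be a homogeneous Poisson point process with intensity $\lambda$ on $[0,\infty)$, with points indexed in increasing order. Suppose that $w \ge 1$. Let $E_{\le 1} := \{|G(X \cap [0,w])| \le 1\}$ be the event that the Gilbert graph on $X \cap [0,w]$ has at most one edge. Let $$I^+ := \inf\{i \ge 2 : X_i - X_{i-1} \le 1\}, \qquad X^+ := (X - X_{I^+}) \cap [1,\infty),$$ and let $\mathcal F^+ := \sigma(X_1, X_2, \dots, X_{I^+}, X^+)$. Then $$\mathbb P(E_{\le 1} \mid \mathcal F^+) = e^{-\lambda((w - X_{I^+})_+ \wedge 1)}\, \mathbf 1\{G(X^+ \cap [1, w - X_{I^+}]) = \emptyset\} \quad \text{almost surely}.$$
   Context: The points of $X$ are ordered so that $X_i \le X_j$ whenever $i \le j$. For a locally finite point set $\varphi \subset \mathbb R$, the Gilbert graph $G(\varphi)$ has the points of $\varphi$ as nodes, with an edge between two distinct points $x, y \in \varphi$ if $|x - y| \le 1$. The graph $G(\varphi)$ is identified with its edge set, so $|G(\varphi)|$ is the number of edges and $G(\varphi) = \emptyset$ means there are no edges. $I^+$ is the index of the first point of $X$ whose predecessor is at distance at most $1$. $X - X_{I^+} := \{X_i - X_{I^+} : i \ge 1\}$. $\mathcal F^+$ is the $\sigma$-algebra generated by the (random-length) sequence $X_1, \dots, X_{I^+}$ and the point process $X^+$. Convention: $[a,b] = \emptyset$ if $a > b$. Notation: $x_+ = \max(x,0)$, $x \wedge y = \min(x,y)$, and $\mathbf 1\{\cdot\}$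 is the indicator. *)

theory Defs
  imports "HOL-Probability.Probability"
begin

definition locally_finite_set :: "real set \<Rightarrow> bool" where
  "locally_finite_set \<phi> \<longleftrightarrow> (\<forall>K. compact K \<longrightarrow> finite (\<phi> \<inter> K))"

text \<open>
  The space of locally finite point configurations, with the \<open>\<sigma>\<close>-algebra generated by
  the counts of points in bounded Borel sets. These counts are finite, so
  \<^const>\<open>card\<close> is the actual number of points.
\<close>

definition config_space :: "real set measure" where
  "config_space = sigma {\<phi>. locally_finite_set \<phi>}
     {{\<phi>. locally_finite_set \<phi> \<and> card (\<phi> \<inter> B) = k} | B k. B \<in> sets borel \<and> bounded B}"

text \<open>
  The Poisson probabilities are written out because \<^const>\<open>poisson_pmf\<close> requires a
  strictly positive rate, whereas Borel sets of Lebesgue measure zero have to be covered too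
  (with \<open>0 ^ 0 = 1\<close>).
\<close>

definition homogeneous_poisson_process ::
    "'a measure \<Rightarrow> real \<Rightarrow> real set \<Rightarrow> ('a \<Rightarrow> real set) \<Rightarrow> bool" where
  "homogeneous_poisson_process M lam S \<Phi> \<longleftrightarrow>
     \<Phi> \<in> measurable M config_space \<and>
     (\<forall>\<omega>\<in>space M. \<Phi> \<omega> \<subseteq> S) \<and>
     (\<forall>B k. B \<in> sets borel \<longrightarrow> bounded B \<longrightarrow> B \<subseteq> S \<longrightarrow>
        measure M {\<omega> \<in> space M. card (\<Phi> \<omega> \<inter> B) = k} =
          (lam * measure lborel B) ^ k / fact k * exp (- (lam * measure lborel B))) \<and>
     (\<forall>(J :: nat set) B. finite J \<longrightarrow> (\<forall>j\<in>J. B j \<in> sets borel \<and> bounded (B j) \<and> B j \<subseteq> S) \<longrightarrow>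
        disjoint_family_on B J \<longrightarrow>
        prob_space.indep_vars M (\<lambda>_. count_space UNIV) (\<lambda>j \<omega>. card (\<Phi> \<omega> \<inter> B j)) J)"

definition gilbert_graph :: "real set \<Rightarrow> real set set" where
  "gilbert_graph \<phi> = {{x, y} | x y. x \<in> \<phi> \<and> y \<in> \<phi> \<and> x \<noteq> y \<and> \<bar>x - y\<bar> \<le> 1}"

text \<open>
  In the following, \<open>x\<close> is a realization of the sequence of points, indexed from 1; the value
  \<open>x 0\<close> is never used.
\<close>

definition point_set :: "(nat \<Rightarrow> real) \<Rightarrow> real set" where
  "point_set x = {x i | i. 1 \<le> i}"

definition I_plus :: "(nat \<Rightarrow> real) \<Rightarrow> enat" where
  "I_plus x = Inf {enat i | i. 2 \<le> i \<and> x i - x (i - 1) \<le> 1}"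

text \<open>
  For a Poisson process, \<open>I_plus\<close> is finite almost surely. On the exceptional null set, where
  there is no such index, the point \<open>x_I_plus\<close> is set to 0 and the initial segment to the
  empty list; otherwise the initial segment is nonempty.
\<close>

definition x_I_plus :: "(nat \<Rightarrow> real) \<Rightarrow> real" where
  "x_I_plus x = (case I_plus x of enat n \<Rightarrow> x n | \<infinity> \<Rightarrow> 0)"

definition initial_points :: "(nat \<Rightarrow> real) \<Rightarrow> real list" where
  "initial_points x = (case I_plus x of enat n \<Rightarrow> map x [1..<Suc n] | \<infinity> \<Rightarrow> [])"

definition X_plus :: "(nat \<Rightarrow> real) \<Rightarrow> real set" where
  "X_plus x = {y - x_I_plus x | y. y \<in> point_set x} \<inter> {1..}"

text \<open>
  Finite sequences of arbitrary length: the disjoint union of the spaces of real \<open>n\<close>-tuples,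
  each with its Borel \<open>\<sigma>\<close>-algebra (generated by the measurable rectangles).
\<close>

definition real_list_space :: "real list measure" where
  "real_list_space = sigma UNIV
     {{xs. length xs = n \<and> (\<forall>i<n. xs ! i \<in> B i)} | n B. \<forall>i. B i \<in> sets borel}"

definition F_plus :: "'a measure \<Rightarrow> (nat \<Rightarrow> 'a \<Rightarrow> real) \<Rightarrow> 'a measure" where
  "F_plus M X = vimage_algebra (space M)
     (\<lambda>\<omega>. (initial_points (\<lambda>i. X i \<omega>), X_plus (\<lambda>i. X i \<omega>)))
     (real_list_space \<Otimes>\<^sub>M config_space)"

end

theory Submission
  imports Defs
begin

text \<open>
  Let \<open>T\<close> be the point of \<open>X\<close> with index \<open>I_plus\<close>, that is, the right end point of the first gap
  of length at most 1. The proof separates what happens in the unit interval after \<open>T\<close> from the rest.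

  If \<open>T \<le> w\<close>, the first short gap is an edge, and it is the only edge up to \<open>T\<close> because all earlier
  gaps are longer than 1. A point in \<open>(T, T + 1]\<close> up to \<open>w\<close> would be adjacent to \<open>T\<close> and give a second
  edge. In the absence of such points, any further edge joins two points of \<open>X\<^sup>+\<close>, shifted by \<open>T\<close>.
  Thus the event of at most one edge is the intersection of two events: there are no points in
  \<open>(T, T + 1] \<inter> (-\<infinity>, w]\<close>, and \<open>X\<^sup>+\<close> has no edge in \<open>[1, w - T]\<close>. Both conditions hold trivially
  if \<open>T > w\<close>, and then there is no edge either (\<open>at_most_one_edge_iff\<close>).

  The second event belongs to \<open>F_plus\<close>. The first one is independent of \<open>F_plus\<close> given \<open>T\<close>, since
  \<open>T\<close> is a stopping time and \<open>F_plus\<close> sees only the points up to \<open>T\<close> and those at distance at least 1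
  beyond it. Its conditional probability is therefore the void probability of an interval of the
  given length, which is the claimed exponential (\<open>void_after_given_start_future\<close>).

  The core is this strong Markov property, \<open>strong_markov_void\<close>. It is obtained by replacing \<open>T\<close> with
  the next larger point of a grid of mesh \<open>1 / (n + 1)\<close>. For each value of the grid point it reduces to
  the independence of a void event on an interval from all counts outside of it
  (\<open>prob_void_indep\<close>), and the mesh then tends to 0. Only interval counts enter, which suffices
  because cylinders over intervals generate the \<open>\<sigma>\<close>-algebra of configurations
  (\<open>sets_config_space_eq_interval_cylinders\<close>). Two null events have to be excluded: the absence of a
  short gap (\<open>AE_start_nonempty\<close>), and a point at distance exactly 1 from \<open>T\<close>
  (\<open>AE_one_notin_future\<close>), which belongs to \<open>X\<^sup>+\<close> as well as to \<open>(T, T + 1]\<close>.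
\<close>

section \<open>Locally finite configurations\<close>

lemma locally_finite_set_Int_bounded:
  assumes "locally_finite_set \<phi>" "bounded B"
  shows "finite (\<phi> \<inter> B)"
proof -
  have "finite (\<phi> \<inter> closure B)"
    using assms by (auto simp: locally_finite_set_def compact_closure)
  then show ?thesis
    by (rule finite_subset[rotated]) (use closure_subset in blast)
qed

text \<open>
  Half-open intervals are what makes approximation from the right work: a point in \<open>(u', v']\<close> lies
  strictly to the right of \<open>u'\<close>, a point beyond \<open>v'\<close> strictly to the right of \<open>v'\<close>, and only
  finitely many points are concerned.
\<close>

lemma locally_finite_set_eventually_Ioc:
  fixes u v :: "nat \<Rightarrow> real"
  assumes \<phi>: "locally_finite_set \<phi>"
    and u: "u \<longlonglongrightarrow> u'" "\<And>n. u' \<le> u n" and v: "v \<longlonglongrightarrow> v'" "\<And>n. v' \<le> v n"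
  shows "eventually (\<lambda>n. \<phi> \<inter> {u n<..v n} = \<phi> \<inter> {u'<..v'}) sequentially"
proof -
  define F where "F = \<phi> \<inter> {u'<..v' + 1}"
  have F: "finite F"
    unfolding F_def by (rule locally_finite_set_Int_bounded[OF \<phi>]) simp
  have 1: "eventually (\<lambda>n. \<forall>y\<in>F. y > u n) sequentially"
    using F by (rule eventually_ball_finite) (auto simp: F_def intro: order_tendstoD(2)[OF u(1)])
  have 2: "eventually (\<lambda>n. \<forall>y\<in>F. y > v' \<longrightarrow> y > v n) sequentially"
    using F by (rule eventually_ball_finite)
      (auto intro: eventually_mono[OF order_tendstoD(2)[OF v(1)]])
  have 3: "eventually (\<lambda>n. v n < v' + 1) sequentially"
    by (rule order_tendstoD(2)[OF v(1)]) simp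
  from 1 2 3 show ?thesis
  proof eventually_elim
    case (elim n)
    have "y \<in> {u n<..v n} \<longleftrightarrow> y \<in> {u'<..v'}" if "y \<in> \<phi>" for y
    proof
      assume y: "y \<in> {u n<..v n}"
      then have "y \<in> F"
        using that elim(3) u(2)[of n] by (auto simp: F_def)
      with y elim(2) u(2)[of n] show "y \<in> {u'<..v'}"
        by fastforce
    next
      assume y: "y \<in> {u'<..v'}"
      then have "y \<in> F"
        using that by (auto simp: F_def)
      with y elim(1) v(2)[of n] show "y \<in> {u n<..v n}"
        by fastforce
    qed
    then show ?case by blast
  qed
qed

lemma space_config_space: "space config_space = {\<phi>. locally_finite_set \<phi>}"
  unfolding config_space_def by (rule space_measure_of) auto

lemma sets_config_space:
  "sets config_space = sigma_sets {\<phi>. locally_finite_set \<phi>}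
     {{\<phi>. locally_finite_set \<phi> \<and> card (\<phi> \<inter> B) = k} | B k. B \<in> sets borel \<and> bounded B}"
  unfolding config_space_def by (rule sets_measure_of) auto

lemma measurable_config_card:
  assumes "B \<in> sets borel" "bounded B"
  shows "(\<lambda>\<phi>. card (\<phi> \<inter> B)) \<in> measurable config_space (count_space UNIV)"
  unfolding measurable_count_space_eq2_countable
proof safe
  fix k
  have "(\<lambda>\<phi>. card (\<phi> \<inter> B)) -` {k} \<inter> space config_space =
      {\<phi>. locally_finite_set \<phi> \<and> card (\<phi> \<inter> B) = k}"
    by (auto simp: space_config_space)
  also have "\<dots> \<in> sets config_space"
    unfolding sets_config_space using assms by (intro sigma_sets.Basic) auto
  finally show "(\<lambda>\<phi>. card (\<phi> \<inter> B)) -` {k} \<inter> space config_space \<in> sets config_space" .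
qed auto

definition interval_cylinders :: "real set set set" where
  "interval_cylinders = {{\<phi>. locally_finite_set \<phi> \<and> (\<forall>j<m. card (\<phi> \<inter> {a j<..b j}) = k j)} |
     (m :: nat) (a :: nat \<Rightarrow> real) b k. True}"

lemma interval_cylindersI:
  fixes m :: nat
  shows "{\<phi>. locally_finite_set \<phi> \<and> (\<forall>j<m. card (\<phi> \<inter> {a j<..b j}) = k j)} \<in> interval_cylinders"
  unfolding interval_cylinders_def by blast

text \<open>Two finite lists of conditions are merged by putting one after the other.\<close>

lemma all_less_add_iff:
  fixes m m' :: nat
  shows "(\<forall>j<m + m'. P (if j < m then f j else g (j - m))) \<longleftrightarrow>
    (\<forall>j<m. P (f j)) \<and> (\<forall>j<m'. P (g j))"
proof safe
  fix j assume H: "\<forall>j<m + m'. P (if j < m then f j else g (j - m))"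
  show "P (f j)" if "j < m"
    using H[rule_format, of j] that by simp
  show "P (g j)" if "j < m'"
    using H[rule_format, of "m + j"] that by simp
next
  fix j assume "\<forall>j<m. P (f j)" "\<forall>j<m'. P (g j)" "j < m + m'"
  then show "P (if j < m then f j else g (j - m))"
    by auto
qed

lemma Int_stable_interval_cylinders: "Int_stable interval_cylinders"
proof (rule Int_stableI)
  fix C D assume "C \<in> interval_cylinders" "D \<in> interval_cylinders"
  then obtain m m' :: nat and a b k a' b' k' where
    C: "C = {\<phi>. locally_finite_set \<phi> \<and> (\<forall>j<m. card (\<phi> \<inter> {a j<..b j}) = k j)}" and
    D: "D = {\<phi>. locally_finite_set \<phi> \<and> (\<forall>j<m'. card (\<phi> \<inter> {a' j<..b' j}) = k' j)}"
    unfolding interval_cylinders_def mem_Collect_eq by blast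
  define f where "f j = (if j < m then (a j, b j, k j) else (a' (j - m), b' (j - m), k' (j - m)))"
    for j
  have "C \<inter> D = {\<phi>. locally_finite_set \<phi> \<and>
      (\<forall>j<m + m'. card (\<phi> \<inter> {fst (f j)<..fst (snd (f j))}) = snd (snd (f j)))}"
    using all_less_add_iff[of m m' "\<lambda>(a, b, k). card (_ \<inter> {a<..b}) = k"
        "\<lambda>j. (a j, b j, k j)" "\<lambda>j. (a' j, b' j, k' j)"]
    unfolding C D f_def by (auto simp: case_prod_unfold)
  also have "\<dots> \<in> interval_cylinders"
    by (rule interval_cylindersI)
  finally show "C \<inter> D \<in> interval_cylinders" .
qed

text \<open>
  Only finitely many terms of the series are nonzero. Passing to the reals makes the count in a
  countable union measurable as a series of measurable functions.
\<close>

lemma card_Int_UN_disjoint_sums: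
  fixes B :: "nat \<Rightarrow> 'a set"
  assumes "finite S" "disjoint_family B"
  shows "(\<lambda>i. real (card (S \<inter> B i))) sums real (card (S \<inter> (\<Union>i. B i)))"
proof -
  define N where "N = {i. S \<inter> B i \<noteq> {}}"
  have fin: "finite N"
  proof -
    have "\<forall>i\<in>N. \<exists>x. x \<in> S \<inter> B i"
      by (auto simp: N_def)
    then obtain f where f: "\<And>i. i \<in> N \<Longrightarrow> f i \<in> S \<inter> B i"
      by metis
    have "inj_on f N"
      using f assms(2) unfolding inj_on_def disjoint_family_on_def by (metis Int_iff UNIV_I empty_iff)
    moreover have "f ` N \<subseteq> S"
      using f by auto
    ultimately show ?thesis
      using assms(1) finite_imageD finite_subset by blast
  qed
  have "card (S \<inter> (\<Union>i. B i)) = card (\<Union>i\<in>N. S \<inter> B i)"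
    by (rule arg_cong[where f=card]) (auto simp: N_def)
  also have "\<dots> = (\<Sum>i\<in>N. card (S \<inter> B i))"
    using assms fin by (intro card_UN_disjoint) (auto simp: disjoint_family_on_def)
  finally have "real (card (S \<inter> (\<Union>i. B i))) = (\<Sum>i\<in>N. real (card (S \<inter> B i)))"
    by simp
  then show ?thesis
    using sums_finite[OF fin, of "\<lambda>i. real (card (S \<inter> B i))"] by (auto simp: N_def)
qed

lemma measurable_real_count_space:
  assumes "(\<lambda>x. real (f x)) \<in> borel_measurable M"
  shows "f \<in> measurable M (count_space UNIV)"
  unfolding measurable_count_space_eq2_countable
proof safe
  fix k
  have "(\<lambda>x. real (f x)) -` {real k} \<inter> space M \<in> sets M"
    by (rule measurable_sets[OF assms]) simp
  also have "(\<lambda>x. real (f x)) -` {real k} = f -` {k}"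
    by auto
  finally show "f -` {k} \<inter> space M \<in> sets M" .
qed auto

text \<open>
  Cylinders over half-open intervals determine the whole configuration: inside a fixed bounded
  window, the Borel sets whose count is measurable form a Dynkin system.
\<close>

lemma sets_config_space_eq_interval_cylinders:
  "sets config_space = sigma_sets {\<phi>. locally_finite_set \<phi>} interval_cylinders"
proof
  let ?S = "{\<phi>. locally_finite_set \<phi>}"
  define N where "N = sigma ?S interval_cylinders"
  have sub: "interval_cylinders \<subseteq> Pow ?S"
    by (auto simp: interval_cylinders_def)
  have sets_N: "sets N = sigma_sets ?S interval_cylinders" and space_N: "space N = ?S"
    unfolding N_def using sub by auto
  have Ioc: "(\<lambda>\<phi>. card (\<phi> \<inter> {a<..b})) \<in> measurable N (count_space UNIV)" for a b :: real
    unfolding measurable_count_space_eq2_countable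
  proof safe
    fix k
    have "(\<lambda>\<phi>. card (\<phi> \<inter> {a<..b})) -` {k} \<inter> space N =
        {\<phi>. locally_finite_set \<phi> \<and> (\<forall>j<1::nat. card (\<phi> \<inter> {a<..b}) = k)}"
      by (auto simp: space_N)
    also have "\<dots> \<in> sets N"
      unfolding sets_N by (intro sigma_sets.Basic interval_cylindersI)
    finally show "(\<lambda>\<phi>. card (\<phi> \<inter> {a<..b})) -` {k} \<inter> space N \<in> sets N" .
  qed auto
  have window: "(\<lambda>\<phi>. card (\<phi> \<inter> {-c<..c} \<inter> B)) \<in> measurable N (count_space UNIV)"
    if "B \<in> sets borel" for B and c :: real
  proof -
    have borel: "sets (borel :: real measure) = sigma_sets UNIV (range (\<lambda>(a, b). {a<..b}))"
      by (subst borel_sigma_sets_Ioc) simp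
    have "Int_stable (range (\<lambda>(a::real, b). {a<..b}))"
      by (auto simp: Int_stable_def)
    moreover have "range (\<lambda>(a::real, b). {a<..b}) \<subseteq> Pow UNIV"
      by simp
    ultimately show ?thesis
      using that[unfolded borel]
    proof (induction rule: sigma_sets_induct_disjoint)
      case (basic A)
      then obtain a b where A: "A = {a<..b}"
        by auto
      have "\<phi> \<inter> {-c<..c} \<inter> A = \<phi> \<inter> {max (-c) a<..min c b}" for \<phi>
        unfolding A by auto
      then show ?case
        using Ioc by simp
    next
      case empty
      then show ?case by simp
    next
      case (compl A)
      have "card (\<phi> \<inter> {-c<..c} \<inter> (UNIV - A)) =
          card (\<phi> \<inter> {-c<..c}) - card (\<phi> \<inter> {-c<..c} \<inter> A)" if "\<phi> \<in> space N" for \<phi>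
      proof -
        have "finite (\<phi> \<inter> {-c<..c} \<inter> A)"
          using that locally_finite_set_Int_bounded[of \<phi> "{-c<..c}"] by (simp add: space_N)
        then show ?thesis
          using card_Diff_subset_Int[of "\<phi> \<inter> {-c<..c}" A] by (simp add: Diff_eq)
      qed
      then show ?case
        using Ioc[of "-c" c] compl(2)
        by (subst measurable_cong[where g="\<lambda>\<phi>. card (\<phi> \<inter> {-c<..c}) - card (\<phi> \<inter> {-c<..c} \<inter> A)"]) auto
    next
      case (union A)
      have "real (card (\<phi> \<inter> {-c<..c} \<inter> (\<Union>i. A i))) =
          (\<Sum>i. real (card (\<phi> \<inter> {-c<..c} \<inter> A i)))" if "\<phi> \<in> space N" for \<phi>
        using that locally_finite_set_Int_bounded[of \<phi> "{-c<..c}"] union(1)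
        by (intro sums_unique card_Int_UN_disjoint_sums) (auto simp: space_N)
      moreover have "(\<lambda>\<phi>. \<Sum>i. real (card (\<phi> \<inter> {-c<..c} \<inter> A i))) \<in> borel_measurable N"
        using union(3) by measurable
      ultimately show ?case
        by (intro measurable_real_count_space) (subst measurable_cong, auto)
    qed
  qed
  have "sigma_sets (space N) {{\<phi>. locally_finite_set \<phi> \<and> card (\<phi> \<inter> B) = k} | B k.
      B \<in> sets borel \<and> bounded B} \<subseteq> sets N"
  proof (rule sets.sigma_sets_subset, safe)
    fix B :: "real set" and k assume B: "B \<in> sets borel" "bounded B"
    obtain c where c: "\<And>x. x \<in> B \<Longrightarrow> \<bar>x\<bar> \<le> c"
      using B(2) by (auto simp: bounded_iff)
    have "\<phi> \<inter> {-(c+1)<..c+1} \<inter> B = \<phi> \<inter> B" for \<phi>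
      using c by force
    with window[OF B(1), of "c + 1"]
    have "(\<lambda>\<phi>. card (\<phi> \<inter> B)) -` {k} \<inter> space N \<in> sets N"
      by (intro measurable_sets[where A="count_space UNIV"]) simp_all
    also have "(\<lambda>\<phi>. card (\<phi> \<inter> B)) -` {k} \<inter> space N = {\<phi>. locally_finite_set \<phi> \<and> card (\<phi> \<inter> B) = k}"
      by (auto simp: space_N)
    finally show "{\<phi>. locally_finite_set \<phi> \<and> card (\<phi> \<inter> B) = k} \<in> sets N" .
  qed
  then show "sets config_space \<subseteq> sigma_sets ?S interval_cylinders"
    by (simp only: sets_config_space sets_N space_N)
  show "sigma_sets ?S interval_cylinders \<subseteq> sets config_space"
    unfolding space_config_space[symmetric]
  proof (rule sets.sigma_sets_subset, safe)
    fix C assume "C \<in> interval_cylinders"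
    then obtain m :: nat and a b k where
      C: "C = {\<phi>. locally_finite_set \<phi> \<and> (\<forall>j<m. card (\<phi> \<inter> {a j<..b j}) = k j)}"
      unfolding interval_cylinders_def by blast
    have [measurable]: "(\<lambda>\<phi>. card (\<phi> \<inter> {a j<..b j})) \<in> measurable config_space (count_space UNIV)"
      for j by (intro measurable_config_card) auto
    have "{\<phi> \<in> space config_space. \<forall>j<m. card (\<phi> \<inter> {a j<..b j}) = k j} \<in> sets config_space"
      by measurable
    then show "C \<in> sets config_space"
      by (simp add: C space_config_space)
  qed
qed

section \<open>Configurations enumerated in increasing order\<close>

lemma I_plus_enatD:
  assumes "I_plus x = enat n"
  shows "2 \<le> n" "x n - x (n - 1) \<le> 1" "\<And>i. 2 \<le> i \<Longrightarrow> i < n \<Longrightarrow> x i - x (i - 1) > 1"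
proof -
  let ?A = "{enat i | i. 2 \<le> i \<and> x i - x (i - 1) \<le> 1}"
  have "?A \<noteq> {}"
  proof
    assume "?A = {}"
    then have "I_plus x = \<infinity>"
      unfolding I_plus_def by (simp only: Inf_empty top_enat_def)
    with assms show False by simp
  qed
  then have "Inf ?A \<in> ?A"
    unfolding Inf_enat_def by (auto intro: LeastI)
  then show "2 \<le> n" "x n - x (n - 1) \<le> 1"
    using assms by (auto simp: I_plus_def)
  fix i assume i: "2 \<le> i" "i < n"
  show "x i - x (i - 1) > 1"
  proof (rule ccontr)
    assume "\<not> ?thesis"
    then have "Inf ?A \<le> enat i"
      using i by (intro Inf_lower) auto
    then show False
      using assms i by (auto simp: I_plus_def)
  qed
qed

lemma I_plus_eq_enat_iff:
  "I_plus x = enat n \<longleftrightarrow>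
    2 \<le> n \<and> x n - x (n - 1) \<le> 1 \<and> (\<forall>i. 2 \<le> i \<and> i < n \<longrightarrow> x i - x (i - 1) > 1)"
proof
  assume "I_plus x = enat n"
  then show "2 \<le> n \<and> x n - x (n - 1) \<le> 1 \<and> (\<forall>i. 2 \<le> i \<and> i < n \<longrightarrow> x i - x (i - 1) > 1)"
    using I_plus_enatD[of x n] by blast
next
  assume R: "2 \<le> n \<and> x n - x (n - 1) \<le> 1 \<and> (\<forall>i. 2 \<le> i \<and> i < n \<longrightarrow> x i - x (i - 1) > 1)"
  then have "I_plus x \<le> enat n"
    unfolding I_plus_def by (intro Inf_lower) auto
  then obtain l where l: "I_plus x = enat l"
    by (cases "I_plus x") auto
  then have "l \<le> n" "2 \<le> l" "x l - x (l - 1) \<le> 1"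
    using \<open>I_plus x \<le> enat n\<close> I_plus_enatD[of x l] by auto
  with R have "l = n"
    by (metis linorder_not_le nat_less_le)
  with l show "I_plus x = enat n" by simp
qed

lemma I_plus_eq_infinity_iff: "I_plus x = \<infinity> \<longleftrightarrow> (\<forall>i\<ge>2. x i - x (i - 1) > 1)"
proof
  assume inf: "I_plus x = \<infinity>"
  show "\<forall>i\<ge>2. x i - x (i - 1) > 1"
  proof (intro allI impI, rule ccontr)
    fix i :: nat assume "2 \<le> i" "\<not> x i - x (i - 1) > 1"
    then have "I_plus x \<le> enat i"
      unfolding I_plus_def by (intro Inf_lower) auto
    with inf show False by simp
  qed
next
  assume "\<forall>i\<ge>2. x i - x (i - 1) > 1"
  then have "I_plus x \<noteq> enat n" for n
    using I_plus_enatD[of x n] by force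
  then show "I_plus x = \<infinity>"
    by (cases "I_plus x") auto
qed

lemma gilbert_graph_eq_empty_iff:
  "gilbert_graph \<phi> = {} \<longleftrightarrow> \<not> (\<exists>x\<in>\<phi>. \<exists>y\<in>\<phi>. x < y \<and> y - x \<le> 1)"
proof
  assume "gilbert_graph \<phi> = {}"
  then show "\<not> (\<exists>x\<in>\<phi>. \<exists>y\<in>\<phi>. x < y \<and> y - x \<le> 1)"
    unfolding gilbert_graph_def by force
next
  assume H: "\<not> (\<exists>x\<in>\<phi>. \<exists>y\<in>\<phi>. x < y \<and> y - x \<le> 1)"
  have False if "x \<in> \<phi>" "y \<in> \<phi>" "x \<noteq> y" "\<bar>x - y\<bar> \<le> 1" for x y
    using H that by (cases x y rule: linorder_cases) (auto simp: abs_if split: if_splits)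
  then show "gilbert_graph \<phi> = {}"
    unfolding gilbert_graph_def by blast
qed

lemma finite_gilbert_graph: "finite \<phi> \<Longrightarrow> finite (gilbert_graph \<phi>)"
  by (rule finite_subset[of _ "Pow \<phi>"]) (auto simp: gilbert_graph_def)

text \<open>
  The first short gap, say \<open>(x\<^sub>n\<^sub>-\<^sub>1, x\<^sub>n)\<close>, is an edge as soon as \<open>x\<^sub>n \<le> w\<close>. All earlier gaps
  are longer than 1, so \<open>x\<^sub>n\<close> has no other neighbour on its left. Hence every further edge in
  \<open>[0, w]\<close> either meets a point of the unit interval to the right of \<open>x\<^sub>n\<close>, which is itself
  adjacent to \<open>x\<^sub>n\<close>, or joins two points at distance more than 1 from \<open>x\<^sub>n\<close>.
\<close>

lemma at_most_one_edge_iff: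
  fixes x :: "nat \<Rightarrow> real" and w :: real
  assumes mono: "strict_mono_on {1..} x" and lf: "locally_finite_set (point_set x)"
    and nonneg: "point_set x \<subseteq> {0..}" and I: "I_plus x = enat n"
  shows "card (gilbert_graph (point_set x \<inter> {0..w})) \<le> 1 \<longleftrightarrow>
    point_set x \<inter> {x_I_plus x<..x_I_plus x + min (max (w - x_I_plus x) 0) 1} = {} \<and>
    gilbert_graph (X_plus x \<inter> {1..w - x_I_plus x}) = {}"
proof -
  define T where "T = x_I_plus x"
  have T: "T = x n"
    by (simp add: T_def x_I_plus_def I)
  note n = I_plus_enatD[OF I]
  have less: "x i < x j \<longleftrightarrow> i < j" if "1 \<le> i" "1 \<le> j" for i j
    using strict_mono_on_less[OF mono, of i j] that by simp
  have le: "x i \<le> x j \<longleftrightarrow> i \<le> j" if "1 \<le> i" "1 \<le> j" for i j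
    using less[of j i] that by (simp flip: not_less)
  \<comment> \<open>An edge ending before or at \<open>x n\<close> can only be the first short gap itself.\<close>
  have left: "i = n - 1 \<and> j = n" if "1 \<le> i" "i < j" "j \<le> n" "x j - x i \<le> 1" for i j
  proof -
    have "x (j - 1) - x i \<ge> 0"
      using le[of i "j - 1"] that by auto
    then have "x j - x (j - 1) \<le> 1"
      using that by simp
    with n(3)[of j] that have j: "j = n"
      by force
    have "\<not> i < n - 1"
    proof
      assume "i < n - 1"
      then have "x (n - 1) - x (n - 2) > 1" "x i \<le> x (n - 2)" "x (n - 1) < x n"
        using n(3)[of "n - 1"] that n(1) le[of i "n - 2"] less[of "n - 1" n]
        by (auto simp: numeral_2_eq_2)
      with that j show False by simp
    qed
    with that j show ?thesis by simp
  qed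
  have X_plus: "X_plus x = {y. y + T \<in> point_set x \<and> 1 \<le> y}"
    unfolding X_plus_def T_def[symmetric] by force
  define s where "s = min (max (w - T) 0) 1"
  let ?G = "gilbert_graph (point_set x \<inter> {0..w})"
  have fin: "finite ?G"
    by (intro finite_gilbert_graph locally_finite_set_Int_bounded[OF lf]) simp
  have "card ?G \<le> 1 \<longleftrightarrow> point_set x \<inter> {T<..T + s} = {} \<and> gilbert_graph (X_plus x \<inter> {1..w - T}) = {}"
  proof (cases "T \<le> w")
    case False
    have "?G = {}"
    proof (unfold gilbert_graph_eq_empty_iff, safe)
      fix p q assume pq: "p \<in> point_set x" "q \<in> point_set x" "p \<in> {0..w}" "q \<in> {0..w}" "p < q" "q - p \<le> 1"
      then obtain i j where ij: "p = x i" "q = x j" "1 \<le> i" "1 \<le> j"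
        by (auto simp: point_set_def)
      have "i < j" "j < n"
        using pq ij less[of i j] less[of j n] n(1) False T by auto
      with left[of i j] ij pq show False by auto
    qed
    then show ?thesis
      using False by (simp add: s_def) (simp add: gilbert_graph_eq_empty_iff)
  next
    case True
    define e where "e = {x (n - 1), x n}"
    have n1: "x (n - 1) < x n" "x (n - 1) \<in> point_set x" "x n \<in> point_set x"
      using less[of "n - 1" n] n(1) by (auto simp: point_set_def)
    have e: "e \<in> ?G"
      unfolding e_def gilbert_graph_def using n1 n(2) nonneg True T by fastforce
    have edge: "{p, q} \<in> ?G" if "p \<in> point_set x" "q \<in> point_set x" "p < q" "q - p \<le> 1" "q \<le> w" for p q
      unfolding gilbert_graph_def using that nonneg by fastforce
    have "card ?G \<le> 1 \<longleftrightarrow> ?G \<subseteq> {e}"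
    proof
      assume "card ?G \<le> 1"
      then show "?G \<subseteq> {e}"
        using e fin card_le_Suc0_iff_eq[OF fin] by auto
    next
      assume "?G \<subseteq> {e}"
      then show "card ?G \<le> 1"
        using card_mono[of "{e}" ?G] by simp
    qed
    also have "\<dots> \<longleftrightarrow> point_set x \<inter> {T<..T + s} = {} \<and> gilbert_graph (X_plus x \<inter> {1..w - T}) = {}"
    proof (intro iffI conjI)
      assume G: "?G \<subseteq> {e}"
      show "point_set x \<inter> {T<..T + s} = {}"
      proof safe
        fix y assume y: "y \<in> point_set x" "y \<in> {T<..T + s}"
        then have "{x n, y} \<in> ?G"
          using n1 True T by (intro edge) (auto simp: s_def)
        with G have "y \<in> e" by auto
        with y n1 T show "y \<in> {}" by (auto simp: e_def)
      qed
      show "gilbert_graph (X_plus x \<inter> {1..w - T}) = {}"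
      proof (unfold gilbert_graph_eq_empty_iff, safe)
        fix p q assume pq: "p \<in> X_plus x" "q \<in> X_plus x" "p \<in> {1..w - T}" "q \<in> {1..w - T}" "p < q" "q - p \<le> 1"
        then have "{p + T, q + T} \<in> ?G"
          by (intro edge) (auto simp: X_plus)
        with G have "q + T \<in> e" by auto
        with pq n1 T show False by (auto simp: e_def)
      qed
    next
      assume R: "point_set x \<inter> {T<..T + s} = {} \<and> gilbert_graph (X_plus x \<inter> {1..w - T}) = {}"
      show "?G \<subseteq> {e}"
      proof
        fix d assume "d \<in> ?G"
        then obtain p q where pq: "d = {p, q}" "p \<in> point_set x" "q \<in> point_set x" "p < q" "q - p \<le> 1" "q \<le> w"
        proof -
          from \<open>d \<in> ?G\<close> obtain y z where yz: "d = {y, z}" "y \<in> point_set x" "z \<in> point_set x" "y \<noteq> z"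
              "\<bar>y - z\<bar> \<le> 1" "y \<le> w" "z \<le> w"
            unfolding gilbert_graph_def by auto
          show thesis
          proof (cases "y < z")
            case True
            then show thesis using yz that[of y z] by auto
          next
            case False
            then show thesis using yz that[of z y] by auto
          qed
        qed
        then obtain i j where ij: "p = x i" "q = x j" "1 \<le> i" "1 \<le> j"
          by (auto simp: point_set_def)
        have "i < j" using ij pq less by auto
        have "j \<le> n"
        proof (rule ccontr)
          assume "\<not> j \<le> n"
          then have qT: "q > T" using less[of n j] n(1) ij T by auto
          show False
          proof (cases "q \<le> T + 1")
            case True
            then have "q \<in> point_set x \<inter> {T<..T + s}"
              using pq qT by (auto simp: s_def)
            with R show False by auto
          next
            case False
            then have "p > T" using pq by simp
            then have "p > T + 1"
              using R pq by (auto simp: s_def)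
            then have "p - T \<in> X_plus x \<inter> {1..w - T}" "q - T \<in> X_plus x \<inter> {1..w - T}"
              using pq by (auto simp: X_plus)
            then have "\<not> (p - T < q - T \<and> q - T - (p - T) \<le> 1)"
              using R unfolding gilbert_graph_eq_empty_iff by blast
            then show False
              using pq by simp
          qed
        qed
        with left[of i j] \<open>i < j\<close> ij pq show "d \<in> {e}"
          by (auto simp: e_def)
      qed
    qed
    finally show ?thesis .
  qed
  then show ?thesis
    by (simp add: s_def T_def)
qed

section \<open>The space of finite sequences\<close>

lemma space_real_list_space: "space real_list_space = UNIV"
  unfolding real_list_space_def by simp

lemma measurable_map_real_list_space:
  assumes "\<And>i. i \<in> set is \<Longrightarrow> f i \<in> borel_measurable N"
  shows "(\<lambda>\<omega>. map (\<lambda>i. f i \<omega>) is) \<in> measurable N real_list_space"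
  unfolding real_list_space_def
proof (rule measurable_measure_of)
  fix C assume "C \<in> {{xs. length xs = n \<and> (\<forall>i<n. xs ! i \<in> B i)} | n B. \<forall>i. B i \<in> sets (borel :: real measure)}"
  then obtain n and B :: "nat \<Rightarrow> real set" where
    C: "C = {xs. length xs = n \<and> (\<forall>i<n. xs ! i \<in> B i)}" and B: "\<And>i. B i \<in> sets borel"
    by blast
  have "{\<omega> \<in> space N. \<forall>i\<in>{..<length is}. f (is ! i) \<omega> \<in> B i} \<in> sets N"
  proof (rule sets.sets_Collect_finite_All)
    fix i assume "i \<in> {..<length is}"
    then have "f (is ! i) -` B i \<inter> space N \<in> sets N"
      using assms B by (intro measurable_sets[of _ _ borel]) auto
    then show "{\<omega> \<in> space N. f (is ! i) \<omega> \<in> B i} \<in> sets N"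
      by (simp add: vimage_def Int_def conj_commute)
  qed simp
  moreover have "(\<lambda>\<omega>. map (\<lambda>i. f i \<omega>) is) -` C \<inter> space N =
      (if n = length is then {\<omega> \<in> space N. \<forall>i\<in>{..<length is}. f (is ! i) \<omega> \<in> B i} else {})"
    by (auto simp: C)
  ultimately show "(\<lambda>\<omega>. map (\<lambda>i. f i \<omega>) is) -` C \<inter> space N \<in> sets N"
    by simp
qed auto

lemma Nil_in_real_list_space: "{[]} \<in> sets real_list_space"
proof -
  have "{xs. length xs = 0 \<and> (\<forall>i<0. xs ! i \<in> (UNIV :: real set))} \<in> sets real_list_space"
    unfolding real_list_space_def by (subst sets_measure_of) (auto intro!: exI[of _ 0])
  then show ?thesis by simp
qed

lemma measurable_last_real_list_space:
  "(\<lambda>xs. if xs = [] then c else last xs) \<in> borel_measurable real_list_space"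
proof (rule measurableI)
  fix A :: "real set" assume A: "A \<in> sets borel"
  have gen: "{xs. length xs = n \<and> (\<forall>i<n. xs ! i \<in> B i)} \<in> sets real_list_space"
    if "\<And>i. B i \<in> sets borel" for n and B :: "nat \<Rightarrow> real set"
    unfolding real_list_space_def using that by (subst sets_measure_of) auto
  have single: "{xs. length xs = Suc n \<and> xs ! n \<in> A} \<in> sets real_list_space" for n
  proof -
    have "{xs. length xs = Suc n \<and> xs ! n \<in> A} =
        {xs. length xs = Suc n \<and> (\<forall>i<Suc n. xs ! i \<in> (if i = n then A else UNIV))}"
      by auto
    also have "\<dots> \<in> sets real_list_space"
      using A by (intro gen) auto
    finally show ?thesis .
  qed
  have "(\<lambda>xs. if xs = [] then c else last xs) -` A \<inter> space real_list_space =
      (if c \<in> A then {[]} else {}) \<union> (\<Union>n. {xs. length xs = Suc n \<and> xs ! n \<in> A})"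
  proof -
    have "xs \<noteq> [] \<Longrightarrow> last xs \<in> A \<longleftrightarrow> (\<exists>n. length xs = Suc n \<and> xs ! n \<in> A)" for xs :: "real list"
      by (cases "length xs") (auto simp: last_conv_nth)
    then show ?thesis
      by (auto simp: space_real_list_space split: if_splits)
  qed
  also have "\<dots> \<in> sets real_list_space"
    using Nil_in_real_list_space single by (intro sets.Un sets.countable_UN) auto
  finally show "(\<lambda>xs. if xs = [] then c else last xs) -` A \<inter> space real_list_space \<in> sets real_list_space" .
qed auto

section \<open>Counts of the process on a region\<close>

locale poisson_line = prob_space M for M :: "'a measure" +
  fixes X :: "nat \<Rightarrow> 'a \<Rightarrow> real" and lam :: real
  assumes poisson: "homogeneous_poisson_process M lam {0..} (\<lambda>\<omega>. point_set (\<lambda>i. X i \<omega>))"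
    and X_strict_mono: "\<And>\<omega>. \<omega> \<in> space M \<Longrightarrow> strict_mono_on {1..} (\<lambda>i. X i \<omega>)"
    and lam_pos: "lam > 0"
begin

definition pts :: "'a \<Rightarrow> real set" where
  "pts \<omega> = point_set (\<lambda>i. X i \<omega>)"

lemma measurable_pts: "pts \<in> measurable M config_space"
  using poisson unfolding homogeneous_poisson_process_def pts_def by blast

lemma locally_finite_pts: "\<omega> \<in> space M \<Longrightarrow> locally_finite_set (pts \<omega>)"
  using measurable_space[OF measurable_pts] by (auto simp: space_config_space)

lemma pts_nonneg: "\<omega> \<in> space M \<Longrightarrow> pts \<omega> \<subseteq> {0..}"
  using poisson unfolding homogeneous_poisson_process_def pts_def by blast

lemma finite_pts_Int: "\<omega> \<in> space M \<Longrightarrow> bounded B \<Longrightarrow> finite (pts \<omega> \<inter> B)"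
  using locally_finite_pts locally_finite_set_Int_bounded by blast

lemma X_less_iff: "\<omega> \<in> space M \<Longrightarrow> 1 \<le> i \<Longrightarrow> 1 \<le> j \<Longrightarrow> X i \<omega> < X j \<omega> \<longleftrightarrow> i < j"
  using strict_mono_on_less[OF X_strict_mono, of \<omega> i j] by simp

lemma X_le_iff: "\<omega> \<in> space M \<Longrightarrow> 1 \<le> i \<Longrightarrow> 1 \<le> j \<Longrightarrow> X i \<omega> \<le> X j \<omega> \<longleftrightarrow> i \<le> j"
  using X_less_iff[of \<omega> j i] by (simp flip: not_less)

lemma measurable_card_pts:
  "B \<in> sets borel \<Longrightarrow> bounded B \<Longrightarrow> (\<lambda>\<omega>. card (pts \<omega> \<inter> B)) \<in> measurable M (count_space UNIV)"
  using measurable_compose[OF measurable_pts measurable_config_card] .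

definition counts_in :: "real set \<Rightarrow> 'a measure" where
  "counts_in S = sigma (space M)
     {{\<omega> \<in> space M. card (pts \<omega> \<inter> B) = k} | B k. B \<in> sets borel \<and> bounded B \<and> B \<subseteq> S}"

lemma space_counts_in [simp]: "space (counts_in S) = space M"
  unfolding counts_in_def by (rule space_measure_of) auto

lemma sets_counts_in:
  "sets (counts_in S) = sigma_sets (space M)
     {{\<omega> \<in> space M. card (pts \<omega> \<inter> B) = k} | B k. B \<in> sets borel \<and> bounded B \<and> B \<subseteq> S}"
  unfolding counts_in_def by (rule sets_measure_of) auto

lemma measurable_card_counts_in:
  assumes "B \<in> sets borel" "bounded B" "B \<subseteq> S"
  shows "(\<lambda>\<omega>. card (pts \<omega> \<inter> B)) \<in> measurable (counts_in S) (count_space UNIV)"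
  unfolding measurable_count_space_eq2_countable
proof safe
  fix k
  have "(\<lambda>\<omega>. card (pts \<omega> \<inter> B)) -` {k} \<inter> space M = {\<omega> \<in> space M. card (pts \<omega> \<inter> B) = k}"
    by auto
  also have "\<dots> \<in> sets (counts_in S)"
    unfolding sets_counts_in using assms by (intro sigma_sets.Basic) auto
  finally show "(\<lambda>\<omega>. card (pts \<omega> \<inter> B)) -` {k} \<inter> space (counts_in S) \<in> sets (counts_in S)"
    by simp
qed auto

lemma counts_in_mono: "S \<subseteq> S' \<Longrightarrow> sets (counts_in S) \<subseteq> sets (counts_in S')"
  unfolding sets_counts_in by (intro sigma_sets_mono') blast

lemma counts_in_subset_events: "sets (counts_in S) \<subseteq> events"
  unfolding sets_counts_in
proof (rule sets.sigma_sets_subset, safe)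
  fix B k assume "B \<in> sets borel" "bounded (B :: real set)"
  from measurable_card_pts[OF this] show "{\<omega> \<in> space M. card (pts \<omega> \<inter> B) = k} \<in> events"
    by measurable
qed

lemma prob_card_pts:
  assumes "0 \<le> a" "a \<le> b"
  shows "prob {\<omega> \<in> space M. card (pts \<omega> \<inter> {a<..b}) = k} =
    (lam * (b - a)) ^ k / fact k * exp (- (lam * (b - a)))"
proof -
  have "prob {\<omega> \<in> space M. card (pts \<omega> \<inter> B) = k} =
      (lam * measure lborel B) ^ k / fact k * exp (- (lam * measure lborel B))"
    if "B \<in> sets borel" "bounded B" "B \<subseteq> {0..}" for B
    using poisson that unfolding homogeneous_poisson_process_def pts_def by blast
  from this[of "{a<..b}"] have "{a<..b} \<subseteq> {0..} \<Longrightarrow> ?thesis"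
    using assms by simp
  moreover have "{a<..b} \<subseteq> {0..}"
    using assms by auto
  ultimately show ?thesis by blast
qed

lemma indep_counts:
  fixes J :: "nat set"
  assumes "finite J" "\<And>j. j \<in> J \<Longrightarrow> B j \<in> sets borel \<and> bounded (B j) \<and> B j \<subseteq> {0..}"
    and "disjoint_family_on B J"
  shows "indep_vars (\<lambda>_. count_space UNIV) (\<lambda>j \<omega>. card (pts \<omega> \<inter> B j)) J"
proof -
  note poisson[unfolded homogeneous_poisson_process_def, THEN conjunct2, THEN conjunct2, THEN conjunct2,
      THEN spec[of _ J], THEN spec[of _ B], THEN mp, THEN mp, THEN mp]
  from this[OF assms(1) _ assms(3)] assms(2) show ?thesis
    unfolding pts_def by blast
qed

text \<open>
  The regions \<open>B j\<close> may overlap, so independence is applied to the atoms of the algebra that they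
  generate: the atom of a point \<open>x\<close> is coded by the list of truth values of \<open>x \<in> B j\<close>. The
  code 0 is left for \<open>D\<close>.
\<close>

lemma prob_counts_void_eq:
  fixes B :: "nat \<Rightarrow> real set" and m :: nat
  assumes B: "\<And>j. j < m \<Longrightarrow> B j \<in> sets borel \<and> bounded (B j) \<and> B j \<subseteq> {0..} - D"
    and D: "D \<in> sets borel" "bounded D" "D \<subseteq> {0..}"
  shows "prob {\<omega> \<in> space M. (\<forall>j<m. card (pts \<omega> \<inter> B j) = k j) \<and> card (pts \<omega> \<inter> D) = 0} =
    prob {\<omega> \<in> space M. \<forall>j<m. card (pts \<omega> \<inter> B j) = k j} * prob {\<omega> \<in> space M. card (pts \<omega> \<inter> D) = 0}"
proof -
  define U where "U = (\<Union>j<m. B j)"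
  define code where "code x = Suc (to_nat (map (\<lambda>j. x \<in> B j) [0..<m]))" for x
  define cell where "cell c = (if c = 0 then D else {x \<in> U. code x = c})" for c
  define N where "N c \<omega> = card (pts \<omega> \<inter> cell c)" for c \<omega>
  have code_eq: "code x = code y \<longleftrightarrow> (\<forall>j<m. x \<in> B j \<longleftrightarrow> y \<in> B j)" for x y
    by (auto simp: code_def)
  have code_pos: "code x \<noteq> 0" for x
    by (simp add: code_def)
  have U: "U \<in> sets borel" "bounded U" "U \<subseteq> {0..} - D"
    unfolding U_def using B by auto
  have fin: "finite (code ` U)"
  proof (rule finite_subset)
    show "code ` U \<subseteq> (\<lambda>l. Suc (to_nat l)) ` {l :: bool list. set l \<subseteq> UNIV \<and> length l = m}"
      by (auto simp: code_def)
    show "finite ((\<lambda>l. Suc (to_nat l)) ` {l :: bool list. set l \<subseteq> UNIV \<and> length l = m})"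
      by (intro finite_imageI finite_lists_length_eq) simp
  qed
  have cell_sets: "cell c \<in> sets borel \<and> bounded (cell c) \<and> cell c \<subseteq> {0..}" if c: "c \<in> insert 0 (code ` U)" for c
  proof (cases "c = 0")
    case True
    then show ?thesis using D by (simp add: cell_def)
  next
    case False
    then obtain y where y: "c = code y"
      using c by auto
    have "cell c = U - (\<Union>j<m. if y \<in> B j then - B j else B j)"
      using False by (auto simp: cell_def y code_eq split: if_splits)
    also have "\<dots> \<in> sets borel"
      using U B by (intro sets.Diff sets.finite_UN) (auto simp: borel_comp)
    finally show ?thesis
      using False U by (auto simp: cell_def intro: bounded_subset[OF U(2)])
  qed
  have "disjoint_family_on cell (insert 0 (code ` U))"
    using U(3) by (auto simp: disjoint_family_on_def cell_def)
  then have indep: "indep_vars (\<lambda>_. count_space UNIV) N (insert 0 (code ` U))"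
    unfolding N_def using fin cell_sets by (intro indep_counts) auto
  have sum_N: "card (pts \<omega> \<inter> B j) = (\<Sum>c\<in>code ` B j. N c \<omega>)" if "\<omega> \<in> space M" "j < m" for \<omega> j
  proof -
    have BU: "B j \<subseteq> U"
      using that by (auto simp: U_def)
    have "pts \<omega> \<inter> B j = (\<Union>c\<in>code ` B j. pts \<omega> \<inter> cell c)"
    proof -
      have "x \<in> cell (code x)" if "x \<in> B j" for x
        using that BU code_pos[of x] by (auto simp: cell_def)
      moreover have "x \<in> B j" if "x \<in> cell (code y)" "y \<in> B j" for x y
      proof -
        have "code x = code y"
          using that(1) code_pos[of y] by (simp add: cell_def)
        with that(2) \<open>j < m\<close> show ?thesis
          unfolding code_eq by simp
      qed
      ultimately have "B j = (\<Union>c\<in>code ` B j. cell c)"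
        by (intro equalityI subsetI) auto
      then show ?thesis
        by (metis Int_UN_distrib)
    qed
    then have "card (pts \<omega> \<inter> B j) = card (\<Union>c\<in>code ` B j. pts \<omega> \<inter> cell c)"
      by (rule arg_cong)
    also have "\<dots> = (\<Sum>c\<in>code ` B j. N c \<omega>)"
      unfolding N_def
    proof (rule card_UN_disjoint)
      show "finite (code ` B j)"
        using finite_subset[OF image_mono[OF BU] fin] .
      show "\<forall>c\<in>code ` B j. finite (pts \<omega> \<inter> cell c)"
      proof
        fix c assume "c \<in> code ` B j"
        then have "bounded (cell c)"
          using BU cell_sets[of c] by blast
        with that(1) show "finite (pts \<omega> \<inter> cell c)"
          by (rule finite_pts_Int)
      qed
      show "\<forall>c\<in>code ` B j. \<forall>c'\<in>code ` B j. c \<noteq> c' \<longrightarrow> pts \<omega> \<inter> cell c \<inter> (pts \<omega> \<inter> cell c') = {}"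
      proof (intro ballI impI)
        fix c c' assume "c \<in> code ` B j" "c' \<in> code ` B j" "c \<noteq> c'"
        then have "cell c \<inter> cell c' = {}"
          using BU \<open>disjoint_family_on cell (insert 0 (code ` U))\<close> unfolding disjoint_family_on_def by blast
        then show "pts \<omega> \<inter> cell c \<inter> (pts \<omega> \<inter> cell c') = {}"
          by blast
      qed
    qed
    finally show ?thesis .
  qed
  have iv: "indep_var (PiM (code ` U) (\<lambda>_. count_space UNIV)) (\<lambda>\<omega>. restrict (\<lambda>c. N c \<omega>) (code ` U))
      (PiM {0} (\<lambda>_. count_space UNIV)) (\<lambda>\<omega>. restrict (\<lambda>c. N c \<omega>) {0})"
  proof (rule indep_var_restrict[OF indep])
    show "code ` U \<inter> {0} = {}"
      by (auto simp: code_def)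
  qed auto
  define Ya where "Ya = {g \<in> space (PiM (code ` U) (\<lambda>_. count_space (UNIV :: nat set))).
      \<forall>j\<in>{..<m}. (\<Sum>c\<in>code ` B j. real (g c)) = real (k j)}"
  define Yb where "Yb = {g \<in> space (PiM {0} (\<lambda>_. count_space (UNIV :: nat set))). g (0::nat) = 0}"
  have Ya: "Ya \<in> sets (PiM (code ` U) (\<lambda>_. count_space UNIV))"
    unfolding Ya_def
  proof (rule sets.sets_Collect_finite_All)
    fix j assume "j \<in> {..<m}"
    then have "code ` B j \<subseteq> code ` U"
      by (auto simp: U_def)
    then have [measurable]: "(\<lambda>g. \<Sum>c\<in>code ` B j. real (g c)) \<in>
        borel_measurable (PiM (code ` U) (\<lambda>_. count_space UNIV))"
      by (intro borel_measurable_sum measurable_compose[OF measurable_component_singleton]) auto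
    show "{g \<in> space (PiM (code ` U) (\<lambda>_. count_space (UNIV :: nat set))).
        (\<Sum>c\<in>code ` B j. real (g c)) = real (k j)} \<in> sets (PiM (code ` U) (\<lambda>_. count_space UNIV))"
      by measurable
  qed simp
  have Yb: "Yb \<in> sets (PiM {0} (\<lambda>_. count_space UNIV))"
    unfolding Yb_def by measurable
  have event_a: "(\<lambda>\<omega>. restrict (\<lambda>c. N c \<omega>) (code ` U)) -` Ya \<inter> space M =
      {\<omega> \<in> space M. \<forall>j<m. card (pts \<omega> \<inter> B j) = k j}"
  proof -
    have "(\<Sum>c\<in>code ` B j. real (restrict (\<lambda>c. N c \<omega>) (code ` U) c)) = real (card (pts \<omega> \<inter> B j))"
      if "\<omega> \<in> space M" "j < m" for \<omega> j
    proof -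
      have "code ` B j \<subseteq> code ` U"
        using that by (auto simp: U_def)
      then have "(\<Sum>c\<in>code ` B j. real (restrict (\<lambda>c. N c \<omega>) (code ` U) c)) =
          (\<Sum>c\<in>code ` B j. real (N c \<omega>))"
        by (intro sum.cong) auto
      then show ?thesis
        using that by (simp add: sum_N)
    qed
    then show ?thesis
      unfolding Ya_def by (auto simp: space_PiM)
  qed
  have event_b: "(\<lambda>\<omega>. restrict (\<lambda>c. N c \<omega>) {0}) -` Yb \<inter> space M = {\<omega> \<in> space M. card (pts \<omega> \<inter> D) = 0}"
    unfolding Yb_def by (auto simp: space_PiM N_def cell_def)
  have "prob ((\<lambda>\<omega>. (restrict (\<lambda>c. N c \<omega>) (code ` U), restrict (\<lambda>c. N c \<omega>) {0})) -` (Ya \<times> Yb) \<inter> space M) =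
      prob ((\<lambda>\<omega>. restrict (\<lambda>c. N c \<omega>) (code ` U)) -` Ya \<inter> space M) *
      prob ((\<lambda>\<omega>. restrict (\<lambda>c. N c \<omega>) {0}) -` Yb \<inter> space M)"
    using iv Ya Yb by (rule indep_varD)
  also have "(\<lambda>\<omega>. (restrict (\<lambda>c. N c \<omega>) (code ` U), restrict (\<lambda>c. N c \<omega>) {0})) -` (Ya \<times> Yb) \<inter> space M =
      ((\<lambda>\<omega>. restrict (\<lambda>c. N c \<omega>) (code ` U)) -` Ya \<inter> space M) \<inter>
      ((\<lambda>\<omega>. restrict (\<lambda>c. N c \<omega>) {0}) -` Yb \<inter> space M)"
    by auto
  also have "\<dots> = {\<omega> \<in> space M. (\<forall>j<m. card (pts \<omega> \<inter> B j) = k j) \<and> card (pts \<omega> \<inter> D) = 0}"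
    unfolding event_a event_b by blast
  finally show ?thesis
    unfolding event_a event_b .
qed

text \<open>
  What happens in \<open>S\<close> is generated by finitely many counts at a time, and these generators are
  stable under intersection, so independence from the void event extends to all of it.
\<close>

lemma prob_void_indep:
  assumes A: "A \<in> sets (counts_in S)" and S: "S \<subseteq> {0..} - {a<..b}" and ab: "0 \<le> a" "a \<le> b"
  shows "prob (A \<inter> {\<omega> \<in> space M. pts \<omega> \<inter> {a<..b} = {}}) = exp (- (lam * (b - a))) * prob A"
proof -
  let ?D = "{a<..b}"
  define V where "V = {\<omega> \<in> space M. pts \<omega> \<inter> ?D = {}}"
  have V: "V = {\<omega> \<in> space M. card (pts \<omega> \<inter> ?D) = 0}"
  proof -
    have "pts \<omega> \<inter> ?D = {} \<longleftrightarrow> card (pts \<omega> \<inter> ?D) = 0" if "\<omega> \<in> space M" for \<omega>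
      by (rule card_0_eq[symmetric]) (rule finite_pts_Int[OF that], simp)
    then show ?thesis
      unfolding V_def by (intro Collect_cong conj_cong refl)
  qed
  have prob_V: "prob V = exp (- (lam * (b - a)))"
    unfolding V using prob_card_pts[OF ab, of 0] by simp
  have V_event: "V \<in> events"
    unfolding V using measurable_card_pts[of ?D] by measurable
  define G where "G = {{\<omega> \<in> space M. \<forall>j<m. card (pts \<omega> \<inter> B j) = k j} | (m :: nat) B k.
      \<forall>j<m. B j \<in> sets borel \<and> bounded (B j) \<and> B j \<subseteq> S}"
  have "sigma_sets (space M) {{\<omega> \<in> space M. card (pts \<omega> \<inter> B) = k} | B k.
      B \<in> sets borel \<and> bounded B \<and> B \<subseteq> S} \<subseteq> sigma_sets (space M) G"
  proof (rule sigma_sets_mono', safe)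
    fix B k assume "B \<in> sets borel" "bounded B" "B \<subseteq> S"
    then show "{\<omega> \<in> space M. card (pts \<omega> \<inter> B) = k} \<in> G"
      unfolding G_def by (intro CollectI exI[of _ 1] exI[of _ "\<lambda>_. B"] exI[of _ "\<lambda>_. k"]) auto
  qed
  with A have A_gen: "A \<in> sigma_sets (space M) G"
    by (auto simp: sets_counts_in)
  have stable: "Int_stable G"
  proof (rule Int_stableI)
    fix C C' assume "C \<in> G" "C' \<in> G"
    then obtain m m' :: nat and B k B' k' where
      C: "C = {\<omega> \<in> space M. \<forall>j<m. card (pts \<omega> \<inter> B j) = k j}"
        "\<forall>j<m. B j \<in> sets borel \<and> bounded (B j) \<and> B j \<subseteq> S" and
      C': "C' = {\<omega> \<in> space M. \<forall>j<m'. card (pts \<omega> \<inter> B' j) = k' j}"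
        "\<forall>j<m'. B' j \<in> sets borel \<and> bounded (B' j) \<and> B' j \<subseteq> S"
      unfolding G_def mem_Collect_eq by blast
    define f where "f j = (if j < m then (B j, k j) else (B' (j - m), k' (j - m)))" for j
    have "C \<inter> C' = {\<omega> \<in> space M. \<forall>j<m + m'. card (pts \<omega> \<inter> fst (f j)) = snd (f j)}"
      using all_less_add_iff[of m m' "\<lambda>(B, k). card (pts _ \<inter> B) = k"
          "\<lambda>j. (B j, k j)" "\<lambda>j. (B' j, k' j)"]
      unfolding C(1) C'(1) f_def by (auto simp: case_prod_unfold)
    moreover have "\<forall>j<m + m'. fst (f j) \<in> sets borel \<and> bounded (fst (f j)) \<and> fst (f j) \<subseteq> S"
      using C(2) C'(2) by (auto simp: f_def)
    ultimately show "C \<inter> C' \<in> G"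
      unfolding G_def mem_Collect_eq
      by (intro exI[of _ "m + m'"] exI[of _ "\<lambda>j. fst (f j)"] exI[of _ "\<lambda>j. snd (f j)"] conjI)
  qed
  have G_sub: "G \<subseteq> Pow (space M)"
    by (auto simp: G_def)
  have G_events: "sigma_sets (space M) G \<subseteq> events"
  proof (rule sets.sigma_sets_subset, safe)
    fix C assume "C \<in> G"
    then obtain m :: nat and B k where
      C: "C = {\<omega> \<in> space M. \<forall>j<m. card (pts \<omega> \<inter> B j) = k j}"
        "\<forall>j<m. B j \<in> sets borel \<and> bounded (B j) \<and> B j \<subseteq> S"
      unfolding G_def mem_Collect_eq by blast
    have "{\<omega> \<in> space M. \<forall>j\<in>{..<m}. card (pts \<omega> \<inter> B j) = k j} \<in> events"
    proof (rule sets.sets_Collect_finite_All)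
      fix j assume "j \<in> {..<m}"
      then have [measurable]: "(\<lambda>\<omega>. card (pts \<omega> \<inter> B j)) \<in> measurable M (count_space UNIV)"
        using C(2) by (intro measurable_card_pts) auto
      show "{\<omega> \<in> space M. card (pts \<omega> \<inter> B j) = k j} \<in> events"
        by measurable
    qed simp
    moreover have "C = {\<omega> \<in> space M. \<forall>j\<in>{..<m}. card (pts \<omega> \<inter> B j) = k j}"
      unfolding C(1) by blast
    ultimately show "C \<in> events"
      by (simp only:)
  qed
  from stable G_sub A_gen have "prob (A \<inter> V) = prob V * prob A"
  proof (induction rule: sigma_sets_induct_disjoint)
    case (basic C)
    then obtain m :: nat and B k where
      C: "C = {\<omega> \<in> space M. \<forall>j<m. card (pts \<omega> \<inter> B j) = k j}"
        "\<forall>j<m. B j \<in> sets borel \<and> bounded (B j) \<and> B j \<subseteq> S"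
      unfolding G_def mem_Collect_eq by blast
    have "prob {\<omega> \<in> space M. (\<forall>j<m. card (pts \<omega> \<inter> B j) = k j) \<and> card (pts \<omega> \<inter> ?D) = 0} =
        prob C * prob V"
      unfolding C(1) V
    proof (rule prob_counts_void_eq)
      show "B j \<in> sets borel \<and> bounded (B j) \<and> B j \<subseteq> {0..} - ?D" if "j < m" for j
        using C(2) S that by (meson subset_trans)
      show "?D \<subseteq> {0..}"
        using ab by auto
    qed simp_all
    also have "{\<omega> \<in> space M. (\<forall>j<m. card (pts \<omega> \<inter> B j) = k j) \<and> card (pts \<omega> \<inter> ?D) = 0} = C \<inter> V"
      unfolding C(1) V by auto
    finally show ?case by simp
  next
    case empty
    then show ?case by simp
  next
    case (compl C)
    have C: "C \<in> events"
      using compl G_events by auto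
    have "(space M - C) \<inter> V = V - C \<inter> V"
      using V_def by auto
    then have "prob ((space M - C) \<inter> V) = prob V - prob (C \<inter> V)"
      using C V_event by (simp add: finite_measure_Diff sets.Int)
    also have "\<dots> = prob V * (1 - prob C)"
      unfolding compl(2) by (simp add: algebra_simps)
    finally show ?case
      unfolding prob_compl[OF C] .
  next
    case (union C)
    have C: "range C \<subseteq> events"
      using union G_events by auto
    have 1: "(\<lambda>i. prob (C i)) sums prob (\<Union>i. C i)"
      using C union by (intro finite_measure_UNION) auto
    have 2: "(\<lambda>i. prob (C i \<inter> V)) sums prob (\<Union>i. C i \<inter> V)"
      using C V_event union(1) by (intro finite_measure_UNION) (auto simp: disjoint_family_on_def)
    have "(\<lambda>i. prob (C i \<inter> V)) sums (prob V * prob (\<Union>i. C i))"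
      using sums_mult[OF 1, of "prob V"] union(3) by simp
    with 2 have "prob (\<Union>i. C i \<inter> V) = prob V * prob (\<Union>i. C i)"
      using sums_unique2 by blast
    then show ?case by simp
  qed
  then show ?thesis
    unfolding prob_V unfolding V_def .
qed

end

section \<open>The points up to the first short gap\<close>

lemma initial_points_enat: "I_plus x = enat n \<Longrightarrow> initial_points x = map x [1..<Suc n]"
  by (simp add: initial_points_def)

lemma initial_points_Nil_iff: "initial_points x = [] \<longleftrightarrow> I_plus x = \<infinity>"
  using I_plus_enatD(1)[of x] by (cases "I_plus x") (auto simp: initial_points_def)

lemma x_I_plus_eq_last: "x_I_plus x = (if initial_points x = [] then 0 else last (initial_points x))"
  using I_plus_enatD(1)[of x] by (cases "I_plus x") (auto simp: initial_points_def x_I_plus_def)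

text \<open>
  Stated for any sequence \<open>Z\<close> and any \<open>\<sigma>\<close>-algebra, since it serves both for the points themselves and
  for the points stopped at a fixed time.
\<close>

lemma sets_I_plus_initial_points:
  fixes Z :: "nat \<Rightarrow> 'a \<Rightarrow> real"
  assumes Z: "\<And>i. 1 \<le> i \<Longrightarrow> Z i \<in> borel_measurable N" and R: "R \<in> sets real_list_space"
  shows "{\<omega> \<in> space N. I_plus (\<lambda>i. Z i \<omega>) = enat n \<and> map (\<lambda>i. Z i \<omega>) [1..<Suc n] \<in> R} \<in> sets N"
proof (cases "2 \<le> n")
  case True
  have gap: "{\<omega> \<in> space N. Z i \<omega> - Z (i - 1) \<omega> > 1} \<in> sets N" if "2 \<le> i" for i
  proof -
    have [measurable]: "Z i \<in> borel_measurable N" "Z (i - 1) \<in> borel_measurable N"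
      using that by (auto intro!: Z)
    show ?thesis by measurable
  qed
  have 1: "{\<omega> \<in> space N. \<forall>i\<in>{2..<n}. Z i \<omega> - Z (i - 1) \<omega> > 1} \<in> sets N"
    by (intro sets.sets_Collect_finite_All gap) auto
  have 2: "space N - {\<omega> \<in> space N. Z n \<omega> - Z (n - 1) \<omega> > 1} \<in> sets N"
    by (intro sets.compl_sets gap True)
  have 3: "(\<lambda>\<omega>. map (\<lambda>i. Z i \<omega>) [1..<Suc n]) -` R \<inter> space N \<in> sets N"
    using R by (intro measurable_sets[OF measurable_map_real_list_space] Z) auto
  have "{\<omega> \<in> space N. I_plus (\<lambda>i. Z i \<omega>) = enat n \<and> map (\<lambda>i. Z i \<omega>) [1..<Suc n] \<in> R} =
      {\<omega> \<in> space N. \<forall>i\<in>{2..<n}. Z i \<omega> - Z (i - 1) \<omega> > 1} \<inter>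
      (space N - {\<omega> \<in> space N. Z n \<omega> - Z (n - 1) \<omega> > 1}) \<inter>
      ((\<lambda>\<omega>. map (\<lambda>i. Z i \<omega>) [1..<Suc n]) -` R \<inter> space N)"
    unfolding I_plus_eq_enat_iff using True by (auto simp del: upt_Suc)
  with 1 2 3 show ?thesis by simp
next
  case False
  then show ?thesis
    unfolding I_plus_eq_enat_iff by simp
qed

context poisson_line
begin

text \<open>
  \<open>edge_end\<close> is the right end point of the first short gap (0 if there is none), \<open>start\<close> lists the points up to it, and
  \<open>future\<close> is the configuration at distance at least 1 to its right, seen from it.
\<close>

abbreviation "edge_end \<omega> \<equiv> x_I_plus (\<lambda>i. X i \<omega>)"

abbreviation "start \<omega> \<equiv> initial_points (\<lambda>i. X i \<omega>)"

abbreviation "future \<omega> \<equiv> X_plus (\<lambda>i. X i \<omega>)"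

lemma X_in_pts: "1 \<le> i \<Longrightarrow> X i \<omega> \<in> pts \<omega>"
  by (auto simp: pts_def point_set_def)

lemma X_nonneg: "\<omega> \<in> space M \<Longrightarrow> 1 \<le> i \<Longrightarrow> 0 \<le> X i \<omega>"
  using X_in_pts pts_nonneg by force

text \<open>
  The enumeration is increasing, so the order statistics can be recovered from the counts; this is
  how the individual points become measurable.
\<close>

lemma X_le_iff_card:
  assumes \<omega>: "\<omega> \<in> space M" and i: "1 \<le> i"
  shows "X i \<omega> \<le> s \<longleftrightarrow> i \<le> card (pts \<omega> \<inter> {0..s})"
proof -
  define J where "J = {j. 1 \<le> j \<and> X j \<omega> \<le> s}"
  have inj: "inj_on (\<lambda>j. X j \<omega>) J"
    using X_less_iff[OF \<omega>] unfolding inj_on_def J_def by (metis (mono_tags, lifting) less_irrefl mem_Collect_eq nat_neq_iff)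
  have image: "(\<lambda>j. X j \<omega>) ` J = pts \<omega> \<inter> {0..s}"
    using X_nonneg[OF \<omega>] by (auto simp: J_def pts_def point_set_def)
  have fin: "finite J"
    using finite_pts_Int[OF \<omega>, of "{0..s}"] finite_imageD[OF _ inj] by (simp add: image)
  have card: "card (pts \<omega> \<inter> {0..s}) = card J"
    using card_image[OF inj] by (simp add: image)
  show ?thesis
  proof
    assume "X i \<omega> \<le> s"
    then have "{1..i} \<subseteq> J"
      using X_le_iff[OF \<omega> _ i] unfolding J_def by (fastforce intro: order_trans)
    then show "i \<le> card (pts \<omega> \<inter> {0..s})"
      using card_mono[OF fin, of "{1..i}"] card by simp
  next
    assume le: "i \<le> card (pts \<omega> \<inter> {0..s})"
    show "X i \<omega> \<le> s"
    proof (rule ccontr)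
      assume "\<not> X i \<omega> \<le> s"
      then have "J \<subseteq> {1..<i}"
        using X_less_iff[OF \<omega> _ i] unfolding J_def by fastforce
      then show False
        using card_mono[of "{1..<i}" J] le card i by simp
    qed
  qed
qed

lemma measurable_X:
  assumes i: "1 \<le> i"
  shows "X i \<in> borel_measurable M"
proof (rule borel_measurable_iff_le[THEN iffD2], rule allI)
  fix s
  have [measurable]: "(\<lambda>\<omega>. card (pts \<omega> \<inter> {0..s})) \<in> measurable M (count_space UNIV)"
    by (intro measurable_card_pts) auto
  have "{\<omega> \<in> space M. X i \<omega> \<le> s} = {\<omega> \<in> space M. i \<le> card (pts \<omega> \<inter> {0..s})}"
    using X_le_iff_card[OF _ i] by blast
  also have "\<dots> \<in> events"
    by measurable
  finally show "{\<omega> \<in> space M. X i \<omega> \<le> s} \<in> events" .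
qed

lemma X_le_counts_in:
  assumes i: "1 \<le> i" and s: "s \<le> t"
  shows "{\<omega> \<in> space M. X i \<omega> \<le> s} \<in> sets (counts_in {0..t})"
proof -
  have [measurable]: "(\<lambda>\<omega>. card (pts \<omega> \<inter> {0..s})) \<in> measurable (counts_in {0..t}) (count_space UNIV)"
    using s by (intro measurable_card_counts_in) auto
  have "{\<omega> \<in> space M. X i \<omega> \<le> s} = {\<omega> \<in> space (counts_in {0..t}). i \<le> card (pts \<omega> \<inter> {0..s})}"
    using X_le_iff_card[OF _ i] by auto
  also have "\<dots> \<in> sets (counts_in {0..t})"
    by measurable
  finally show ?thesis .
qed

lemma measurable_min_X_counts_in:
  assumes i: "1 \<le> i"
  shows "(\<lambda>\<omega>. min (X i \<omega>) t) \<in> borel_measurable (counts_in {0..t})"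
proof (rule borel_measurable_iff_le[THEN iffD2], rule allI)
  fix s
  show "{\<omega> \<in> space (counts_in {0..t}). min (X i \<omega>) t \<le> s} \<in> sets (counts_in {0..t})"
  proof (cases "t \<le> s")
    case True
    then have "{\<omega> \<in> space (counts_in {0..t}). min (X i \<omega>) t \<le> s} = space (counts_in {0..t})"
      by auto
    then show ?thesis
      using sets.top by metis
  next
    case False
    then have "{\<omega> \<in> space (counts_in {0..t}). min (X i \<omega>) t \<le> s} = {\<omega> \<in> space M. X i \<omega> \<le> s}"
      by auto
    then show ?thesis
      using X_le_counts_in[OF i, of s t] False by simp
  qed
qed

text \<open>
  The end point of the first short gap is a stopping time: whether the gap ends before \<open>t\<close>, and
  the points up to its end, can be read off from the variables \<open>min (X i) t\<close>.
\<close>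

lemma start_in_counts_in:
  assumes R: "R \<in> sets real_list_space" and R_le: "\<And>xs. xs \<in> R \<Longrightarrow> xs \<noteq> [] \<and> last xs \<le> t"
  shows "{\<omega> \<in> space M. start \<omega> \<in> R} \<in> sets (counts_in {0..t})"
proof -
  define Z where "Z i \<omega> = min (X i \<omega>) t" for i \<omega>
  have eq: "Z i \<omega> = X i \<omega>" if "\<omega> \<in> space M" "X n \<omega> \<le> t" "1 \<le> i" "i \<le> n" for i n \<omega>
    using X_le_iff[of \<omega> i n] that by (simp add: Z_def)
  have I_eq: "I_plus (\<lambda>i. Z i \<omega>) = enat n \<longleftrightarrow> I_plus (\<lambda>i. X i \<omega>) = enat n"
    and map_eq: "map (\<lambda>i. Z i \<omega>) [1..<Suc n] = map (\<lambda>i. X i \<omega>) [1..<Suc n]"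
    if "\<omega> \<in> space M" "X n \<omega> \<le> t" for n \<omega>
    unfolding I_plus_eq_enat_iff using eq[OF that] by (auto simp del: upt_Suc)
  have "{\<omega> \<in> space M. start \<omega> \<in> R} = (\<Union>n\<in>{1..}. {\<omega> \<in> space M. X n \<omega> \<le> t} \<inter>
      {\<omega> \<in> space (counts_in {0..t}). I_plus (\<lambda>i. Z i \<omega>) = enat n \<and> map (\<lambda>i. Z i \<omega>) [1..<Suc n] \<in> R})"
  proof (intro equalityI subsetI)
    fix \<omega> assume "\<omega> \<in> {\<omega> \<in> space M. start \<omega> \<in> R}"
    then have \<omega>: "\<omega> \<in> space M" "start \<omega> \<in> R" by auto
    then obtain n where n: "I_plus (\<lambda>i. X i \<omega>) = enat n"
      using R_le initial_points_Nil_iff by (cases "I_plus (\<lambda>i. X i \<omega>)") blast+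
    then have "1 \<le> n" "X n \<omega> \<le> t"
      using I_plus_enatD(1)[OF n] R_le[OF \<omega>(2)] by (auto simp: initial_points_enat)
    moreover from this have "map (\<lambda>i. Z i \<omega>) [1..<Suc n] \<in> R" "I_plus (\<lambda>i. Z i \<omega>) = enat n"
      using \<omega> n I_eq[of \<omega> n] map_eq[of \<omega> n] initial_points_enat[OF n] by (simp_all only:)
    ultimately show "\<omega> \<in> (\<Union>n\<in>{1..}. {\<omega> \<in> space M. X n \<omega> \<le> t} \<inter>
      {\<omega> \<in> space (counts_in {0..t}). I_plus (\<lambda>i. Z i \<omega>) = enat n \<and> map (\<lambda>i. Z i \<omega>) [1..<Suc n] \<in> R})"
      using \<omega> by (auto simp del: upt_Suc)
  next
    fix \<omega> assume "\<omega> \<in> (\<Union>n\<in>{1..}. {\<omega> \<in> space M. X n \<omega> \<le> t} \<inter>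
      {\<omega> \<in> space (counts_in {0..t}). I_plus (\<lambda>i. Z i \<omega>) = enat n \<and> map (\<lambda>i. Z i \<omega>) [1..<Suc n] \<in> R})"
    then obtain n where n: "\<omega> \<in> space M" "X n \<omega> \<le> t" "I_plus (\<lambda>i. Z i \<omega>) = enat n"
      "map (\<lambda>i. Z i \<omega>) [1..<Suc n] \<in> R" by (auto simp del: upt_Suc)
    then have "I_plus (\<lambda>i. X i \<omega>) = enat n" "map (\<lambda>i. X i \<omega>) [1..<Suc n] \<in> R"
      using I_eq[of \<omega> n] map_eq[of \<omega> n] by (simp_all only:)
    with n(1) show "\<omega> \<in> {\<omega> \<in> space M. start \<omega> \<in> R}"
      by (simp only: initial_points_enat mem_Collect_eq simp_thms)
  qed
  also have "\<dots> \<in> sets (counts_in {0..t})"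
  proof (rule sets.countable_UN'')
    fix n :: nat assume "n \<in> {1..}"
    then show "{\<omega> \<in> space M. X n \<omega> \<le> t} \<inter> {\<omega> \<in> space (counts_in {0..t}).
        I_plus (\<lambda>i. Z i \<omega>) = enat n \<and> map (\<lambda>i. Z i \<omega>) [1..<Suc n] \<in> R} \<in> sets (counts_in {0..t})"
      unfolding Z_def
      by (intro sets.Int X_le_counts_in sets_I_plus_initial_points measurable_min_X_counts_in R) auto
  qed simp
  finally show ?thesis .
qed

lemma measurable_start: "start \<in> measurable M real_list_space"
proof (rule measurableI)
  fix R assume R: "R \<in> sets real_list_space"
  have E: "{\<omega> \<in> space M. I_plus (\<lambda>i. X i \<omega>) = enat n \<and> map (\<lambda>i. X i \<omega>) [1..<Suc n] \<in> S} \<in> events"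
    if "S \<in> sets real_list_space" for n S
    using that by (intro sets_I_plus_initial_points measurable_X) auto
  have fin: "(\<Union>n. {\<omega> \<in> space M. I_plus (\<lambda>i. X i \<omega>) = enat n \<and> map (\<lambda>i. X i \<omega>) [1..<Suc n] \<in> S}) \<in> events"
    if "S \<in> sets real_list_space" for S
    using E[OF that] by (intro sets.countable_UN) auto
  have "UNIV \<in> sets real_list_space"
    using sets.top[of real_list_space] by (simp add: space_real_list_space)
  from fin[OF this] have inf: "space M - (\<Union>n. {\<omega> \<in> space M. I_plus (\<lambda>i. X i \<omega>) = enat n \<and>
      map (\<lambda>i. X i \<omega>) [1..<Suc n] \<in> UNIV}) \<in> events"
    by (rule sets.compl_sets)
  have "start -` R \<inter> space M =
      (\<Union>n. {\<omega> \<in> space M. I_plus (\<lambda>i. X i \<omega>) = enat n \<and> map (\<lambda>i. X i \<omega>) [1..<Suc n] \<in> R}) \<union>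
      (if [] \<in> R then space M - (\<Union>n. {\<omega> \<in> space M. I_plus (\<lambda>i. X i \<omega>) = enat n \<and>
      map (\<lambda>i. X i \<omega>) [1..<Suc n] \<in> UNIV}) else {})"
  proof (intro set_eqI)
    fix \<omega>
    show "\<omega> \<in> start -` R \<inter> space M \<longleftrightarrow> \<omega> \<in>
      (\<Union>n. {\<omega> \<in> space M. I_plus (\<lambda>i. X i \<omega>) = enat n \<and> map (\<lambda>i. X i \<omega>) [1..<Suc n] \<in> R}) \<union>
      (if [] \<in> R then space M - (\<Union>n. {\<omega> \<in> space M. I_plus (\<lambda>i. X i \<omega>) = enat n \<and>
      map (\<lambda>i. X i \<omega>) [1..<Suc n] \<in> UNIV}) else {})"
      by (cases "I_plus (\<lambda>i. X i \<omega>)") (auto simp: initial_points_def simp del: upt_Suc)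
  qed
  also have "\<dots> \<in> events"
    using fin[OF R] inf by simp
  finally show "start -` R \<inter> space M \<in> events" .
qed (simp add: space_real_list_space)

lemma edge_end_eq_last: "edge_end \<omega> = (if start \<omega> = [] then 0 else last (start \<omega>))"
  by (rule x_I_plus_eq_last)

lemma measurable_edge_end: "edge_end \<in> borel_measurable M"
  unfolding edge_end_eq_last[abs_def]
  using measurable_compose[OF measurable_start measurable_last_real_list_space[of 0]] .

lemma edge_end_nonneg: "\<omega> \<in> space M \<Longrightarrow> 0 \<le> edge_end \<omega>"
  using X_nonneg[of \<omega>] I_plus_enatD(1)[of "\<lambda>i. X i \<omega>"]
  by (cases "I_plus (\<lambda>i. X i \<omega>)") (force simp: x_I_plus_def)+

lemma future_eq: "future \<omega> = {y. 1 \<le> y \<and> y + edge_end \<omega> \<in> pts \<omega>}"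
  unfolding X_plus_def pts_def by force

lemma locally_finite_future:
  assumes "\<omega> \<in> space M"
  shows "locally_finite_set (future \<omega>)"
  unfolding locally_finite_set_def
proof safe
  fix K :: "real set" assume "compact K"
  then have "bounded ((\<lambda>y. edge_end \<omega> + y) ` K)"
    by (intro compact_imp_bounded compact_translation)
  then have "finite (pts \<omega> \<inter> (\<lambda>y. edge_end \<omega> + y) ` K)"
    by (rule finite_pts_Int[OF assms])
  then have "finite ((\<lambda>y. y - edge_end \<omega>) ` (pts \<omega> \<inter> (\<lambda>y. edge_end \<omega> + y) ` K))"
    by simp
  then show "finite (future \<omega> \<inter> K)"
    by (rule finite_subset[rotated]) (force simp: future_eq add.commute)
qed

text \<open>
  The map from indices to points is injective, so a count of points is the cardinality of a random
  set of indices.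
\<close>

lemma measurable_future: "future \<in> measurable M config_space"
  unfolding config_space_def
proof (rule measurable_measure_of)
  show "future \<in> space M \<rightarrow> {\<phi>. locally_finite_set \<phi>}"
    using locally_finite_future by auto
  fix C assume "C \<in> {{\<phi>. locally_finite_set \<phi> \<and> card (\<phi> \<inter> B) = k} | B k. B \<in> sets borel \<and> bounded B}"
  then obtain B k where C: "C = {\<phi>. locally_finite_set \<phi> \<and> card (\<phi> \<inter> B) = k}" and B: "B \<in> sets borel"
    by blast
  have "{\<omega> \<in> space M. i \<in> {i. 1 \<le> i \<and> X i \<omega> - edge_end \<omega> \<in> {1..} \<inter> B}} \<in> events" for i
  proof (cases "1 \<le> i")
    case True
    have [measurable]: "X i \<in> borel_measurable M" "edge_end \<in> borel_measurable M" "{1..} \<inter> B \<in> sets borel"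
      using measurable_X[OF True] measurable_edge_end B by auto
    have "{\<omega> \<in> space M. X i \<omega> - edge_end \<omega> \<in> {1..} \<inter> B} \<in> events"
      by measurable
    with True show ?thesis by simp
  qed simp
  then have meas: "(\<lambda>\<omega>. card {i. 1 \<le> i \<and> X i \<omega> - edge_end \<omega> \<in> {1..} \<inter> B}) \<in>
      measurable M (count_space UNIV)"
    by (rule measurable_card)
  have "card (future \<omega> \<inter> B) = card {i. 1 \<le> i \<and> X i \<omega> - edge_end \<omega> \<in> {1..} \<inter> B}"
    if \<omega>: "\<omega> \<in> space M" for \<omega>
  proof -
    have inj: "inj_on (\<lambda>i. X i \<omega> - edge_end \<omega>) {i. 1 \<le> i \<and> X i \<omega> - edge_end \<omega> \<in> {1..} \<inter> B}"
      using strict_mono_on_imp_inj_on[OF X_strict_mono[OF \<omega>]] by (auto simp: inj_on_def)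
    have image: "(\<lambda>i. X i \<omega> - edge_end \<omega>) ` {i. 1 \<le> i \<and> X i \<omega> - edge_end \<omega> \<in> {1..} \<inter> B} = future \<omega> \<inter> B"
      unfolding X_plus_def point_set_def by force
    show ?thesis
      using card_image[OF inj] unfolding image .
  qed
  then have "future -` C \<inter> space M =
      (\<lambda>\<omega>. card {i. 1 \<le> i \<and> X i \<omega> - edge_end \<omega> \<in> {1..} \<inter> B}) -` {k} \<inter> space M"
    using locally_finite_future by (auto simp: C)
  also have "\<dots> \<in> events"
    by (rule measurable_sets[OF meas]) simp
  finally show "future -` C \<inter> space M \<in> events" .
qed auto

end

section \<open>The strong Markov property at the end of the first short gap\<close>

text \<open>
  The smallest multiple of \<open>1 / (n + 1)\<close> that is strictly larger than \<open>x\<close>, for \<open>x \<ge> 0\<close>.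
\<close>

definition grid_above :: "nat \<Rightarrow> real \<Rightarrow> real" where
  "grid_above n x = (real (nat \<lfloor>x * real (Suc n)\<rfloor>) + 1) / real (Suc n)"

lemma grid_above_bounds:
  assumes "0 \<le> x"
  shows "x < grid_above n x" "grid_above n x \<le> x + 1 / real (Suc n)"
proof -
  have "real (nat \<lfloor>x * real (Suc n)\<rfloor>) = real_of_int \<lfloor>x * real (Suc n)\<rfloor>"
    using assms by simp
  then have "x * real (Suc n) < real (nat \<lfloor>x * real (Suc n)\<rfloor>) + 1"
      "real (nat \<lfloor>x * real (Suc n)\<rfloor>) \<le> x * real (Suc n)"
    by linarith+
  then show "x < grid_above n x" "grid_above n x \<le> x + 1 / real (Suc n)"
    unfolding grid_above_def by (auto simp: field_simps simp del: of_nat_Suc)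
qed

lemma grid_above_tendsto:
  assumes "0 \<le> x"
  shows "(\<lambda>n. grid_above n x) \<longlonglongrightarrow> x"
proof (rule tendsto_sandwich)
  show "\<forall>\<^sub>F n in sequentially. x \<le> grid_above n x" "\<forall>\<^sub>F n in sequentially. grid_above n x \<le> x + 1 / real (Suc n)"
    using grid_above_bounds[OF assms] by (auto intro!: always_eventually less_imp_le)
  show "(\<lambda>n. x + 1 / real (Suc n)) \<longlonglongrightarrow> x"
    using tendsto_add[OF tendsto_const[of x] LIMSEQ_Suc[OF lim_1_over_n[where 'a=real]]] by simp
qed auto

text \<open>
  \<open>K\<close> takes countably many values, so integrals can be compared on each piece \<open>K = i\<close>; this turns a
  statement at a fixed time into one at a random time with countably many values.
\<close>

lemma integral_eq_pieces:
  fixes p r :: "nat \<Rightarrow> 'a \<Rightarrow> real" and K :: "'a \<Rightarrow> nat"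
  assumes p [measurable]: "\<And>i. (\<lambda>\<omega>. of_bool (K \<omega> = i) * p i \<omega>) \<in> borel_measurable M"
    and r [measurable]: "\<And>i. (\<lambda>\<omega>. of_bool (K \<omega> = i) * r i \<omega>) \<in> borel_measurable M"
    and nonneg: "\<And>i \<omega>. 0 \<le> p i \<omega>" "\<And>i \<omega>. 0 \<le> r i \<omega>"
    and eq: "\<And>i. (\<integral>\<^sup>+\<omega>. ennreal (of_bool (K \<omega> = i) * p i \<omega>) \<partial>M) =
      (\<integral>\<^sup>+\<omega>. ennreal (of_bool (K \<omega> = i) * r i \<omega>) \<partial>M)"
  shows "(\<lambda>\<omega>. p (K \<omega>) \<omega>) \<in> borel_measurable M" "(\<lambda>\<omega>. r (K \<omega>) \<omega>) \<in> borel_measurable M"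
    "(\<integral>\<omega>. p (K \<omega>) \<omega> \<partial>M) = (\<integral>\<omega>. r (K \<omega>) \<omega> \<partial>M)"
proof -
  have meas: "(\<lambda>\<omega>. q (K \<omega>) \<omega>) \<in> borel_measurable M"
    if [measurable]: "\<And>i. (\<lambda>\<omega>. of_bool (K \<omega> = i) * q i \<omega>) \<in> borel_measurable M" for q :: "nat \<Rightarrow> 'a \<Rightarrow> real"
  proof -
    have "(\<Sum>i. of_bool (K \<omega> = i) * q i \<omega>) = q (K \<omega>) \<omega>" for \<omega>
      using sums_unique[OF sums_single[of "K \<omega>" "\<lambda>i. q i \<omega>"]]
      by (simp add: of_bool_def if_distrib[of "\<lambda>x. x * _"] eq_commute cong: if_cong)
    moreover have "(\<lambda>\<omega>. \<Sum>i. of_bool (K \<omega> = i) * q i \<omega>) \<in> borel_measurable M"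
      by measurable
    ultimately show ?thesis by simp
  qed
  have nn: "(\<integral>\<^sup>+\<omega>. ennreal (q (K \<omega>) \<omega>) \<partial>M) = (\<Sum>i. \<integral>\<^sup>+\<omega>. ennreal (of_bool (K \<omega> = i) * q i \<omega>) \<partial>M)"
    if [measurable]: "\<And>i. (\<lambda>\<omega>. of_bool (K \<omega> = i) * q i \<omega>) \<in> borel_measurable M" for q :: "nat \<Rightarrow> 'a \<Rightarrow> real"
  proof -
    have *: "ennreal (of_bool (K \<omega> = i) * q i \<omega>) = (if i = K \<omega> then ennreal (q i \<omega>) else 0)" for i \<omega>
      by auto
    have "(\<Sum>i. ennreal (of_bool (K \<omega> = i) * q i \<omega>)) = ennreal (q (K \<omega>) \<omega>)" for \<omega>
      unfolding * using sums_unique[OF sums_single[of "K \<omega>" "\<lambda>i. ennreal (q i \<omega>)"]] by simp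
    then have "(\<integral>\<^sup>+\<omega>. ennreal (q (K \<omega>) \<omega>) \<partial>M) = (\<integral>\<^sup>+\<omega>. (\<Sum>i. ennreal (of_bool (K \<omega> = i) * q i \<omega>)) \<partial>M)"
      by simp
    also have "\<dots> = (\<Sum>i. \<integral>\<^sup>+\<omega>. ennreal (of_bool (K \<omega> = i) * q i \<omega>) \<partial>M)"
      by (intro nn_integral_suminf) measurable
    finally show ?thesis .
  qed
  show m: "(\<lambda>\<omega>. p (K \<omega>) \<omega>) \<in> borel_measurable M" "(\<lambda>\<omega>. r (K \<omega>) \<omega>) \<in> borel_measurable M"
    by (rule meas, rule p, rule meas, rule r)
  have "(\<integral>\<^sup>+\<omega>. ennreal (p (K \<omega>) \<omega>) \<partial>M) = (\<integral>\<^sup>+\<omega>. ennreal (r (K \<omega>) \<omega>) \<partial>M)"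
    unfolding nn[OF p] nn[OF r] eq ..
  then show "(\<integral>\<omega>. p (K \<omega>) \<omega> \<partial>M) = (\<integral>\<omega>. r (K \<omega>) \<omega> \<partial>M)"
    using m nonneg by (simp add: integral_eq_nn_integral)
qed

context poisson_line
begin

lemma start_grid_cell_counts_in:
  assumes R: "R \<in> sets real_list_space" and t: "t = (real i + 1) / real (Suc n)"
  shows "{\<omega> \<in> space M. start \<omega> \<in> R \<and> start \<omega> \<noteq> [] \<and> nat \<lfloor>edge_end \<omega> * real (Suc n)\<rfloor> = i} \<in> sets (counts_in {0..t})"
proof -
  \<comment> \<open>The empty list is sent beyond \<open>t\<close>, so that it is excluded together with the late end points.\<close>
  define l where "l xs = (if xs = [] then t + 1 else last xs)" for xs :: "real list"
  define R' where "R' = R \<inter> (l -` ({x. nat \<lfloor>x * real (Suc n)\<rfloor> = i} \<inter> {..t}) \<inter> space real_list_space)"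
  have "{x::real. nat \<lfloor>x * real (Suc n)\<rfloor> = i} \<in> sets borel"
    by measurable
  then have "R' \<in> sets real_list_space"
    unfolding R'_def l_def by (intro sets.Int R measurable_sets[OF measurable_last_real_list_space]) auto
  moreover have "xs \<noteq> [] \<and> last xs \<le> t" if "xs \<in> R'" for xs
    using that by (auto simp: R'_def l_def split: if_splits)
  ultimately have "{\<omega> \<in> space M. start \<omega> \<in> R'} \<in> sets (counts_in {0..t})"
    by (rule start_in_counts_in)
  also have "{\<omega> \<in> space M. start \<omega> \<in> R'} =
      {\<omega> \<in> space M. start \<omega> \<in> R \<and> start \<omega> \<noteq> [] \<and> nat \<lfloor>edge_end \<omega> * real (Suc n)\<rfloor> = i}"
  proof -
    have le: "x \<le> t" if "nat \<lfloor>x * real (Suc n)\<rfloor> = i" for x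
    proof -
      have "x * real (Suc n) \<le> real i + 1"
        using that by linarith
      then show ?thesis
        unfolding t by (simp add: pos_le_divide_eq del: of_nat_Suc)
    qed
    have "start \<omega> \<in> R' \<longleftrightarrow> start \<omega> \<in> R \<and> start \<omega> \<noteq> [] \<and> nat \<lfloor>edge_end \<omega> * real (Suc n)\<rfloor> = i" for \<omega>
    proof (cases "start \<omega> = []")
      case True
      then show ?thesis by (simp add: R'_def l_def)
    next
      case False
      then have "edge_end \<omega> = last (start \<omega>)" "l (start \<omega>) = last (start \<omega>)"
        by (simp_all add: edge_end_eq_last l_def)
      then show ?thesis
        using False le[of "last (start \<omega>)"] by (auto simp: R'_def space_real_list_space simp del: of_nat_Suc)
    qed
    then show ?thesis by simp
  qed
  finally show ?thesis .
qed

text \<open>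
  The end point is approximated from the right by grid points. When the grid point is \<open>t\<close>, the
  conditions on the initial segment concern \<open>[0, t]\<close> and the remaining ones concern
  \<open>(t + 1, \<infinity>)\<close>, so both are independent of the void event on \<open>(u t, v t]\<close>. Counts in half-open
  intervals are eventually constant under this approximation, and this allows passing to the limit.
\<close>

lemma strong_markov_void:
  fixes u v :: "real \<Rightarrow> real" and a b :: "nat \<Rightarrow> real" and k :: "nat \<Rightarrow> nat" and m :: nat
  assumes R: "R \<in> sets real_list_space"
    and uv: "\<And>t. 0 \<le> t \<Longrightarrow> t \<le> u t" "\<And>t. 0 \<le> t \<Longrightarrow> u t \<le> v t" "\<And>t. 0 \<le> t \<Longrightarrow> v t \<le> t + 1"
    and mono: "mono u" "mono v" and cont: "continuous_on UNIV u" "continuous_on UNIV v"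
    and a: "\<And>j. j < m \<Longrightarrow> 1 \<le> a j"
  defines "A \<equiv> \<lambda>\<omega>. start \<omega> \<in> R \<and> start \<omega> \<noteq> [] \<and>
    (\<forall>j<m. card (pts \<omega> \<inter> {edge_end \<omega> + a j<..edge_end \<omega> + b j}) = k j)"
  shows "(\<integral>\<omega>. of_bool (A \<omega> \<and> pts \<omega> \<inter> {u (edge_end \<omega>)<..v (edge_end \<omega>)} = {}) \<partial>M) =
      (\<integral>\<omega>. of_bool (A \<omega>) * exp (- (lam * (v (edge_end \<omega>) - u (edge_end \<omega>)))) \<partial>M)"
    and "{\<omega> \<in> space M. A \<omega> \<and> pts \<omega> \<inter> {u (edge_end \<omega>)<..v (edge_end \<omega>)} = {}} \<in> events"
proof -
  define C where "C t \<omega> \<longleftrightarrow> start \<omega> \<in> R \<and> start \<omega> \<noteq> [] \<and>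
      (\<forall>j<m. card (pts \<omega> \<inter> {t + a j<..t + b j}) = k j)" for t \<omega>
  define f where "f t \<omega> = (of_bool (C t \<omega> \<and> pts \<omega> \<inter> {u t<..v t} = {}) :: real)" for t \<omega>
  define g where "g t \<omega> = of_bool (C t \<omega>) * exp (- (lam * (v t - u t)))" for t \<omega>
  define \<tau> where "\<tau> n \<omega> = grid_above n (edge_end \<omega>)" for n \<omega>
  have step: "(\<lambda>\<omega>. f (\<tau> n \<omega>) \<omega>) \<in> borel_measurable M \<and> (\<lambda>\<omega>. g (\<tau> n \<omega>) \<omega>) \<in> borel_measurable M \<and>
    (\<integral>\<omega>. f (\<tau> n \<omega>) \<omega> \<partial>M) = (\<integral>\<omega>. g (\<tau> n \<omega>) \<omega> \<partial>M)" for n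
  proof -
    \<comment> \<open>\<open>K\<close> is the index of the grid cell of the end point and \<open>c i\<close> the right end of cell \<open>i\<close>.\<close>
    define K where "K \<omega> = nat \<lfloor>edge_end \<omega> * real (Suc n)\<rfloor>" for \<omega>
    define c where "c i = (real i + 1) / real (Suc n)" for i
    have c: "0 \<le> c i" for i
      by (simp add: c_def)
    have \<tau>: "\<tau> n \<omega> = c (K \<omega>)" for \<omega>
      by (simp add: \<tau>_def grid_above_def c_def K_def)
    define P where "P i = {\<omega> \<in> space M. K \<omega> = i \<and> C (c i) \<omega>}" for i
    define V where "V i = {\<omega> \<in> space M. pts \<omega> \<inter> {u (c i)<..v (c i)} = {}}" for i
    have P: "P i \<in> sets (counts_in ({0..} - {u (c i)<..v (c i)}))" for i
    proof -
      let ?S = "{0..} - {u (c i)<..v (c i)}"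
      have "{\<omega> \<in> space M. start \<omega> \<in> R \<and> start \<omega> \<noteq> [] \<and> K \<omega> = i} \<in> sets (counts_in {0..c i})"
        unfolding K_def by (rule start_grid_cell_counts_in[OF R]) (simp add: c_def)
      moreover have "{0..c i} \<subseteq> ?S"
        using uv(1)[OF c[of i]] by auto
      ultimately have 1: "{\<omega> \<in> space M. start \<omega> \<in> R \<and> start \<omega> \<noteq> [] \<and> K \<omega> = i} \<in> sets (counts_in ?S)"
        using counts_in_mono by blast
      have 2: "{\<omega> \<in> space (counts_in ?S). \<forall>j\<in>{..<m}. card (pts \<omega> \<inter> {c i + a j<..c i + b j}) = k j} \<in> sets (counts_in ?S)"
      proof (rule sets.sets_Collect_finite_All)
        fix j assume "j \<in> {..<m}"
        then have "{c i + a j<..c i + b j} \<subseteq> ?S"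
          using uv(3)[OF c[of i]] a[of j] c[of i] by auto
        then have "(\<lambda>\<omega>. card (pts \<omega> \<inter> {c i + a j<..c i + b j})) \<in> measurable (counts_in ?S) (count_space UNIV)"
          by (intro measurable_card_counts_in) auto
        from measurable_sets[OF this, of "{k j}"]
        show "{\<omega> \<in> space (counts_in ?S). card (pts \<omega> \<inter> {c i + a j<..c i + b j}) = k j} \<in> sets (counts_in ?S)"
          by (simp add: vimage_def Int_def conj_commute)
      qed simp
      have "P i = {\<omega> \<in> space M. start \<omega> \<in> R \<and> start \<omega> \<noteq> [] \<and> K \<omega> = i} \<inter>
          {\<omega> \<in> space (counts_in ?S). \<forall>j\<in>{..<m}. card (pts \<omega> \<inter> {c i + a j<..c i + b j}) = k j}"
        by (auto simp: P_def C_def)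
      with 1 2 show ?thesis
        by (simp only: sets.Int)
    qed
    have P_event: "P i \<in> events" for i
      using P counts_in_subset_events by blast
    have V_event: "V i \<in> events" for i
    proof -
      have "(\<lambda>\<omega>. card (pts \<omega> \<inter> {u (c i)<..v (c i)})) -` {0} \<inter> space M \<in> events"
        by (intro measurable_sets[OF measurable_card_pts]) auto
      also have "(\<lambda>\<omega>. card (pts \<omega> \<inter> {u (c i)<..v (c i)})) -` {0} \<inter> space M = V i"
      proof -
        have "card (pts \<omega> \<inter> {u (c i)<..v (c i)}) = 0 \<longleftrightarrow> pts \<omega> \<inter> {u (c i)<..v (c i)} = {}" if "\<omega> \<in> space M" for \<omega>
          by (rule card_0_eq) (rule finite_pts_Int[OF that], simp)
        then show ?thesis
          unfolding V_def vimage_def Int_def[of _ "space M"] by (auto simp only: mem_Collect_eq singleton_iff)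
      qed
      finally show ?thesis .
    qed
    have PV: "prob (P i \<inter> V i) = exp (- (lam * (v (c i) - u (c i)))) * prob (P i)" for i
      unfolding V_def using uv(1,2)[OF c[of i]] c[of i] by (intro prob_void_indep[OF P]) auto
    have f_eq: "of_bool (K \<omega> = i) * f (c i) \<omega> = indicator (P i \<inter> V i) \<omega>" if "\<omega> \<in> space M" for i \<omega>
      using that by (simp add: f_def P_def V_def indicator_def)
    have g_eq: "of_bool (K \<omega> = i) * g (c i) \<omega> = indicator (P i) \<omega> * exp (- (lam * (v (c i) - u (c i))))"
      if "\<omega> \<in> space M" for i \<omega>
      using that by (simp add: g_def P_def indicator_def)
    have f_meas: "(\<lambda>\<omega>. of_bool (K \<omega> = i) * f (c i) \<omega>) \<in> borel_measurable M" for i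
    proof -
      have "(indicator (P i \<inter> V i) :: _ \<Rightarrow> real) \<in> borel_measurable M"
        using P_event V_event by (intro borel_measurable_indicator sets.Int)
      then show ?thesis
        by (subst measurable_cong[OF f_eq]) auto
    qed
    have g_meas: "(\<lambda>\<omega>. of_bool (K \<omega> = i) * g (c i) \<omega>) \<in> borel_measurable M" for i
    proof -
      have "(\<lambda>\<omega>. indicator (P i) \<omega> * exp (- (lam * (v (c i) - u (c i))))) \<in> borel_measurable M"
        using P_event by (intro borel_measurable_times borel_measurable_indicator) auto
      then show ?thesis
        by (subst measurable_cong[OF g_eq]) auto
    qed
    have nn_eq: "(\<integral>\<^sup>+\<omega>. ennreal (of_bool (K \<omega> = i) * f (c i) \<omega>) \<partial>M) =
        (\<integral>\<^sup>+\<omega>. ennreal (of_bool (K \<omega> = i) * g (c i) \<omega>) \<partial>M)" for i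
    proof -
      have "(\<integral>\<^sup>+\<omega>. ennreal (of_bool (K \<omega> = i) * f (c i) \<omega>) \<partial>M) = (\<integral>\<^sup>+\<omega>. indicator (P i \<inter> V i) \<omega> \<partial>M)"
        by (rule nn_integral_cong) (simp add: f_eq ennreal_indicator)
      also have "\<dots> = emeasure M (P i \<inter> V i)"
        using P_event V_event by (intro nn_integral_indicator sets.Int)
      also have "\<dots> = ennreal (exp (- (lam * (v (c i) - u (c i))))) * emeasure M (P i)"
        by (simp add: emeasure_eq_measure PV ennreal_mult)
      also have "\<dots> = (\<integral>\<^sup>+\<omega>. ennreal (exp (- (lam * (v (c i) - u (c i))))) * indicator (P i) \<omega> \<partial>M)"
        using P_event by (rule nn_integral_cmult_indicator[symmetric])
      also have "\<dots> = (\<integral>\<^sup>+\<omega>. ennreal (of_bool (K \<omega> = i) * g (c i) \<omega>) \<partial>M)"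
        by (rule nn_integral_cong) (simp add: g_eq indicator_def)
      finally show ?thesis .
    qed
    show ?thesis
      unfolding \<tau>
      using integral_eq_pieces[of K "\<lambda>i. f (c i)" M "\<lambda>i. g (c i)", OF f_meas g_meas _ _ nn_eq]
      by (auto simp: f_def g_def)
  qed
  have \<tau>_ge: "edge_end \<omega> \<le> \<tau> n \<omega>" and \<tau>_lim: "(\<lambda>n. \<tau> n \<omega>) \<longlonglongrightarrow> edge_end \<omega>" if "\<omega> \<in> space M" for n \<omega>
    unfolding \<tau>_def using grid_above_bounds(1)[OF edge_end_nonneg[OF that]]
      grid_above_tendsto[OF edge_end_nonneg[OF that]] by (auto intro: less_imp_le)
  have u_lim: "(\<lambda>n. u (\<tau> n \<omega>)) \<longlonglongrightarrow> u (edge_end \<omega>)" and v_lim: "(\<lambda>n. v (\<tau> n \<omega>)) \<longlonglongrightarrow> v (edge_end \<omega>)"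
    if "\<omega> \<in> space M" for \<omega>
    using continuous_on_tendsto_compose[OF cont(1) \<tau>_lim[OF that]]
      continuous_on_tendsto_compose[OF cont(2) \<tau>_lim[OF that]] by auto
  \<comment> \<open>The grid points tend to the end point from strictly to the right, so the counts stabilize.\<close>
  have C_ev: "\<forall>\<^sub>F n in sequentially. C (\<tau> n \<omega>) \<omega> \<longleftrightarrow> C (edge_end \<omega>) \<omega>" if \<omega>: "\<omega> \<in> space M" for \<omega>
  proof -
    have "\<forall>\<^sub>F n in sequentially. \<forall>j\<in>{..<m}. pts \<omega> \<inter> {\<tau> n \<omega> + a j<..\<tau> n \<omega> + b j} =
        pts \<omega> \<inter> {edge_end \<omega> + a j<..edge_end \<omega> + b j}"
    proof (rule eventually_ball_finite)
      show "\<forall>j\<in>{..<m}. \<forall>\<^sub>F n in sequentially. pts \<omega> \<inter> {\<tau> n \<omega> + a j<..\<tau> n \<omega> + b j} =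
          pts \<omega> \<inter> {edge_end \<omega> + a j<..edge_end \<omega> + b j}"
        using \<tau>_ge[OF \<omega>] \<tau>_lim[OF \<omega>]
        by (intro ballI locally_finite_set_eventually_Ioc[OF locally_finite_pts[OF \<omega>]] tendsto_intros) auto
    qed simp
    then show ?thesis
    proof eventually_elim
      case (elim n)
      then have "card (pts \<omega> \<inter> {\<tau> n \<omega> + a j<..\<tau> n \<omega> + b j}) =
          card (pts \<omega> \<inter> {edge_end \<omega> + a j<..edge_end \<omega> + b j})" if "j < m" for j
        using that by (simp only: lessThan_iff)
      then show ?case
        unfolding C_def by (metis (no_types))
    qed
  qed
  have f_lim: "(\<lambda>n. f (\<tau> n \<omega>) \<omega>) \<longlonglongrightarrow> f (edge_end \<omega>) \<omega>" if \<omega>: "\<omega> \<in> space M" for \<omega>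
  proof (rule tendsto_eventually)
    have "\<forall>\<^sub>F n in sequentially. pts \<omega> \<inter> {u (\<tau> n \<omega>)<..v (\<tau> n \<omega>)} = pts \<omega> \<inter> {u (edge_end \<omega>)<..v (edge_end \<omega>)}"
      using \<tau>_ge[OF \<omega>] mono u_lim[OF \<omega>] v_lim[OF \<omega>]
      by (intro locally_finite_set_eventually_Ioc[OF locally_finite_pts[OF \<omega>]]) (auto dest: monoD)
    with C_ev[OF \<omega>] show "\<forall>\<^sub>F n in sequentially. f (\<tau> n \<omega>) \<omega> = f (edge_end \<omega>) \<omega>"
      by eventually_elim (simp only: f_def)
  qed
  have g_lim: "(\<lambda>n. g (\<tau> n \<omega>) \<omega>) \<longlonglongrightarrow> g (edge_end \<omega>) \<omega>" if \<omega>: "\<omega> \<in> space M" for \<omega>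
    unfolding g_def
  proof (intro tendsto_intros u_lim v_lim \<omega>)
    show "(\<lambda>n. of_bool (C (\<tau> n \<omega>) \<omega>) :: real) \<longlonglongrightarrow> of_bool (C (edge_end \<omega>) \<omega>)"
      using C_ev[OF \<omega>] by (intro tendsto_eventually) (auto elim: eventually_mono)
  qed
  have f_meas: "(\<lambda>\<omega>. f (edge_end \<omega>) \<omega>) \<in> borel_measurable M"
    by (rule borel_measurable_LIMSEQ_real[where u="\<lambda>n \<omega>. f (\<tau> n \<omega>) \<omega>"], rule f_lim)
      (use step in blast)+
  have g_meas: "(\<lambda>\<omega>. g (edge_end \<omega>) \<omega>) \<in> borel_measurable M"
    by (rule borel_measurable_LIMSEQ_real[where u="\<lambda>n \<omega>. g (\<tau> n \<omega>) \<omega>"], rule g_lim)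
      (use step in blast)+
  have f_bound: "norm (f t \<omega>) \<le> 1" for t \<omega>
    by (simp add: f_def)
  have g_bound: "norm (g t \<omega>) \<le> 1" if "0 \<le> t" for t \<omega>
    using uv(2)[OF that] lam_pos by (simp add: g_def)
  have "(\<lambda>n. \<integral>\<omega>. f (\<tau> n \<omega>) \<omega> \<partial>M) \<longlonglongrightarrow> (\<integral>\<omega>. f (edge_end \<omega>) \<omega> \<partial>M)"
  proof (rule integral_dominated_convergence[where w="\<lambda>_. 1"])
    show "AE \<omega> in M. (\<lambda>n. f (\<tau> n \<omega>) \<omega>) \<longlonglongrightarrow> f (edge_end \<omega>) \<omega>"
      by (rule AE_I2) (rule f_lim)
    show "AE \<omega> in M. norm (f (\<tau> n \<omega>) \<omega>) \<le> 1" for n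
      by (rule AE_I2) (rule f_bound)
  qed (use f_meas step in blast | simp)+
  moreover have "(\<lambda>n. \<integral>\<omega>. g (\<tau> n \<omega>) \<omega> \<partial>M) \<longlonglongrightarrow> (\<integral>\<omega>. g (edge_end \<omega>) \<omega> \<partial>M)"
  proof (rule integral_dominated_convergence[where w="\<lambda>_. 1"])
    show "AE \<omega> in M. (\<lambda>n. g (\<tau> n \<omega>) \<omega>) \<longlonglongrightarrow> g (edge_end \<omega>) \<omega>"
      by (rule AE_I2) (rule g_lim)
    show "AE \<omega> in M. norm (g (\<tau> n \<omega>) \<omega>) \<le> 1" for n
    proof (rule AE_I2)
      fix \<omega> assume "\<omega> \<in> space M"
      then have "0 \<le> \<tau> n \<omega>"
        using \<tau>_ge[of \<omega> n] edge_end_nonneg[of \<omega>] by linarith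
      then show "norm (g (\<tau> n \<omega>) \<omega>) \<le> 1"
        by (rule g_bound)
    qed
  qed (use g_meas step in blast | simp)+
  moreover have "(\<integral>\<omega>. f (\<tau> n \<omega>) \<omega> \<partial>M) = (\<integral>\<omega>. g (\<tau> n \<omega>) \<omega> \<partial>M)" for n
    using step by blast
  ultimately have "(\<integral>\<omega>. f (edge_end \<omega>) \<omega> \<partial>M) = (\<integral>\<omega>. g (edge_end \<omega>) \<omega> \<partial>M)"
    by (simp add: LIMSEQ_unique)
  then show "(\<integral>\<omega>. of_bool (A \<omega> \<and> pts \<omega> \<inter> {u (edge_end \<omega>)<..v (edge_end \<omega>)} = {}) \<partial>M) =
      (\<integral>\<omega>. of_bool (A \<omega>) * exp (- (lam * (v (edge_end \<omega>) - u (edge_end \<omega>)))) \<partial>M)"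
    unfolding f_def g_def C_def A_def .
  have "(\<lambda>\<omega>. f (edge_end \<omega>) \<omega>) -` {1} \<inter> space M \<in> events"
    by (rule measurable_sets[OF f_meas]) simp
  also have "(\<lambda>\<omega>. f (edge_end \<omega>) \<omega>) -` {1} \<inter> space M =
      {\<omega> \<in> space M. A \<omega> \<and> pts \<omega> \<inter> {u (edge_end \<omega>)<..v (edge_end \<omega>)} = {}}"
    unfolding f_def C_def A_def vimage_def Int_def[of _ "space M"]
    by (simp only: of_bool_eq_1_iff mem_Collect_eq singleton_iff conj_commute)
  finally show "{\<omega> \<in> space M. A \<omega> \<and> pts \<omega> \<inter> {u (edge_end \<omega>)<..v (edge_end \<omega>)} = {}} \<in> events" .
qed

end

section \<open>Null events\<close>

context poisson_line
begin

lemma prob_card_pts_le_1: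
  assumes "0 \<le> a"
  shows "prob {\<omega> \<in> space M. card (pts \<omega> \<inter> {a<..a + 1}) \<le> 1} = (1 + lam) * exp (- lam)"
proof -
  have ev: "{\<omega> \<in> space M. card (pts \<omega> \<inter> {a<..a + 1}) = k} \<in> events" for k
  proof -
    have "(\<lambda>\<omega>. card (pts \<omega> \<inter> {a<..a + 1})) -` {k} \<inter> space M \<in> events"
      by (intro measurable_sets[OF measurable_card_pts]) auto
    then show ?thesis
      by (simp add: vimage_def Int_def conj_commute)
  qed
  have p: "prob {\<omega> \<in> space M. card (pts \<omega> \<inter> {a<..a + 1}) = k} = lam ^ k / fact k * exp (- lam)" for k
    using prob_card_pts[of a "a + 1" k] assms by simp
  have "{\<omega> \<in> space M. card (pts \<omega> \<inter> {a<..a + 1}) \<le> 1} =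
      {\<omega> \<in> space M. card (pts \<omega> \<inter> {a<..a + 1}) = 0} \<union> {\<omega> \<in> space M. card (pts \<omega> \<inter> {a<..a + 1}) = 1}"
    by (auto simp only: le_Suc_eq One_nat_def)
  also have "prob \<dots> = prob {\<omega> \<in> space M. card (pts \<omega> \<inter> {a<..a + 1}) = 0} +
      prob {\<omega> \<in> space M. card (pts \<omega> \<inter> {a<..a + 1}) = 1}"
    by (intro finite_measure_Union ev) (simp only: disjoint_iff mem_Collect_eq, metis zero_neq_one)
  also have "\<dots> = lam ^ 0 / fact 0 * exp (- lam) + lam ^ 1 / fact 1 * exp (- lam)"
    by (simp only: p)
  also have "\<dots> = (1 + lam) * exp (- lam)"
    by (simp add: algebra_simps)
  finally show ?thesis .
qed

text \<open>
  Without a short gap, each of the independent unit intervals \<open>(i, i + 1]\<close> holds at most one point.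
\<close>

lemma AE_start_nonempty: "AE \<omega> in M. start \<omega> \<noteq> []"
proof -
  \<comment> \<open>The probability that a unit interval holds at most one point.\<close>
  define q where "q = (1 + lam) * exp (- lam)"
  have q: "0 \<le> q" "q < 1"
  proof -
    have "ln (1 + lam) < lam"
      using lam_pos by (rule ln_add_one_self_less_self)
    then have "1 + lam < exp lam"
      using lam_pos by (metis add_pos_pos exp_less_cancel_iff exp_ln zero_less_one)
    then show "0 \<le> q" "q < 1"
      using lam_pos by (auto simp: q_def exp_minus field_simps)
  qed
  define E where "E = {\<omega> \<in> space M. start \<omega> = []}"
  have E_event: "E \<in> events"
    using measurable_sets[OF measurable_start Nil_in_real_list_space]
    by (simp add: E_def vimage_def Int_def conj_commute)
  have "prob E \<le> q ^ n" if n: "1 \<le> n" for n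
  proof -
    have n_ne: "{..<n} \<noteq> {}"
      using n by (simp add: lessThan_empty_iff)
    define Y where "Y i \<omega> = card (pts \<omega> \<inter> {real i<..real i + 1})" for i \<omega>
    have disj: "disjoint_family_on (\<lambda>i::nat. {real i<..real i + 1}) {..<n}"
      unfolding disjoint_family_on_def
    proof (intro ballI impI)
      fix i j :: nat assume "i \<noteq> j"
      then have "real i + 1 \<le> real j \<or> real j + 1 \<le> real i"
        by linarith
      then show "{real i<..real i + 1} \<inter> {real j<..real j + 1} = {}"
        by auto
    qed
    have indep: "indep_vars (\<lambda>_. count_space UNIV) Y {..<n}"
      unfolding Y_def by (rule indep_counts[OF _ _ disj]) auto
    have "E \<subseteq> (\<Inter>i\<in>{..<n}. Y i -` {..1} \<inter> space M)"
    proof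
      fix \<omega> assume \<omega>: "\<omega> \<in> E"
      then have sp: "\<omega> \<in> space M" by (simp add: E_def)
      have gap: "X j \<omega> - X (j - 1) \<omega> > 1" if "2 \<le> j" for j
        using \<omega> that by (simp add: E_def initial_points_Nil_iff I_plus_eq_infinity_iff)
      have apart: "1 < X j \<omega> - X l \<omega>" if "1 \<le> l" "l < j" for l j
      proof -
        have "1 \<le> j - 1" "l \<le> j - 1" "2 \<le> j"
          using that by linarith+
        then show ?thesis
          using gap[of j] X_le_iff[OF sp that(1), of "j - 1"] by linarith
      qed
      have "y = z" if y: "y \<in> pts \<omega> \<inter> {real i<..real i + 1}" and z: "z \<in> pts \<omega> \<inter> {real i<..real i + 1}" for y z i
      proof -
        from y z obtain j l where jl: "y = X j \<omega>" "1 \<le> j" "z = X l \<omega>" "1 \<le> l"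
          by (auto simp: pts_def point_set_def)
        have "j = l"
          using y z apart[of j l] apart[of l j] jl by (cases j l rule: linorder_cases) auto
        with jl show ?thesis by simp
      qed
      moreover have "finite (pts \<omega> \<inter> {real i<..real i + 1})" for i
        using sp by (rule finite_pts_Int) simp
      ultimately have "Y i \<omega> \<le> 1" for i
        unfolding Y_def One_nat_def using card_le_Suc0_iff_eq[of "pts \<omega> \<inter> {real i<..real i + 1}"] by blast
      with sp show "\<omega> \<in> (\<Inter>i\<in>{..<n}. Y i -` {..1} \<inter> space M)"
        by simp
    qed
    then have "prob E \<le> prob (\<Inter>i\<in>{..<n}. Y i -` {..1} \<inter> space M)"
    proof (rule finite_measure_mono)
      have "Y i -` {..1} \<inter> space M \<in> events" for i
        unfolding Y_def by (intro measurable_sets[OF measurable_card_pts]) auto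
      then show "(\<Inter>i\<in>{..<n}. Y i -` {..1} \<inter> space M) \<in> events"
        using n_ne by (intro sets.finite_INT) auto
    qed
    also have "\<dots> = (\<Prod>i\<in>{..<n}. prob (Y i -` {..1} \<inter> space M))"
      using n_ne by (intro indep_varsD[OF indep]) auto
    also have "\<dots> = (\<Prod>i\<in>{..<n}. q)"
    proof (rule prod.cong)
      fix i
      have "Y i -` {..1} \<inter> space M = {\<omega> \<in> space M. card (pts \<omega> \<inter> {real i<..real i + 1}) \<le> 1}"
        by (auto simp: Y_def)
      then show "prob (Y i -` {..1} \<inter> space M) = q"
        using prob_card_pts_le_1[of "real i"] by (simp add: q_def)
    qed simp
    finally show ?thesis by simp
  qed
  moreover have "(\<lambda>n. q ^ n) \<longlonglongrightarrow> 0"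
    using q by (intro LIMSEQ_power_zero) simp
  ultimately have "prob E \<le> 0"
    by (intro LIMSEQ_le_const[of "\<lambda>n. q ^ n"]) auto
  then have "prob E = 0"
    by (simp add: measure_le_0_iff)
  then have "AE \<omega> in M. \<omega> \<notin> E"
    using E_event prob_eq_0 by blast
  then show ?thesis
    by (auto simp: E_def elim: AE_mp)
qed

text \<open>
  The strong Markov property for \<open>(t + 1 - \<delta>, t + 1]\<close>, with \<open>\<delta>\<close> tending to 0, shows that almost
  surely no point lies at distance exactly 1 from the end of the first short gap.
\<close>

lemma AE_one_notin_future: "AE \<omega> in M. 1 \<notin> future \<omega>"
proof -
  define S where "S = {\<omega> \<in> space M. start \<omega> \<noteq> []}"
  define E where "E = {\<omega> \<in> space M. 1 \<in> future \<omega>}"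
  have top: "UNIV \<in> sets real_list_space"
    using sets.top[of real_list_space] by (simp add: space_real_list_space)
  have S_event: "S \<in> events"
    using measurable_sets[OF measurable_start sets.compl_sets[OF Nil_in_real_list_space]]
    by (simp add: S_def vimage_def Int_def conj_commute space_real_list_space)
  have prob_S: "prob S = 1"
    using AE_start_nonempty S_event by (subst prob_eq_1) (auto simp: S_def)
  have E_event: "E \<in> events"
  proof -
    have "(\<lambda>\<omega>. card (future \<omega> \<inter> {1})) -` {1} \<inter> space M \<in> events"
      by (intro measurable_sets[OF measurable_compose[OF measurable_future measurable_config_card]]) auto
    also have "(\<lambda>\<omega>. card (future \<omega> \<inter> {1})) -` {1} \<inter> space M = E"
    proof -
      have "card (future \<omega> \<inter> {1}) = 1 \<longleftrightarrow> 1 \<in> future \<omega>" for \<omega>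
        by (cases "1 \<in> future \<omega>") simp_all
      then show ?thesis
        by (auto simp: E_def)
    qed
    finally show ?thesis .
  qed
  have bound: "prob E \<le> 1 - exp (- (lam * d))" if d: "0 < d" "d \<le> 1" for d
  proof -
    define B where "B = {\<omega> \<in> space M. start \<omega> \<noteq> [] \<and> pts \<omega> \<inter> {edge_end \<omega> + 1 - d<..edge_end \<omega> + 1} = {}}"
    have *: "(\<And>t. 0 \<le> t \<Longrightarrow> t \<le> t + 1 - d)" "(\<And>t. 0 \<le> t \<Longrightarrow> t + 1 - d \<le> t + 1)" "(\<And>t::real. 0 \<le> t \<Longrightarrow> t + 1 \<le> t + 1)"
      "mono (\<lambda>t. t + 1 - d)" "mono (\<lambda>t::real. t + 1)"
      "continuous_on UNIV (\<lambda>t. t + 1 - d)" "continuous_on UNIV (\<lambda>t::real. t + 1)"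
      using d by (auto simp: mono_def intro!: continuous_intros)
    note sm = strong_markov_void[OF top *, where m=0, simplified]
    have B: "B \<in> events"
      unfolding B_def by (rule sm(2))
    have "prob B = (\<integral>\<omega>. indicator B \<omega> \<partial>M)"
      using B by simp
    also have "\<dots> = (\<integral>\<omega>. of_bool (start \<omega> \<noteq> [] \<and> pts \<omega> \<inter> {edge_end \<omega> + 1 - d<..edge_end \<omega> + 1} = {}) \<partial>M)"
      by (rule Bochner_Integration.integral_cong) (simp_all add: B_def indicator_def)
    also have "\<dots> = (\<integral>\<omega>. of_bool (start \<omega> \<noteq> []) * exp (- (lam * d)) \<partial>M)"
      using sm(1) by simp
    also have "\<dots> = (\<integral>\<omega>. indicator S \<omega> * exp (- (lam * d)) \<partial>M)"
      by (rule Bochner_Integration.integral_cong) (simp_all add: S_def indicator_def)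
    also have "\<dots> = exp (- (lam * d))"
      using S_event prob_S by simp
    finally have prob_B: "prob B = exp (- (lam * d))" .
    have "1 \<notin> future \<omega>" if "\<omega> \<in> B" for \<omega>
    proof
      assume "1 \<in> future \<omega>"
      then have "edge_end \<omega> + 1 \<in> pts \<omega> \<inter> {edge_end \<omega> + 1 - d<..edge_end \<omega> + 1}"
        using d by (simp add: future_eq add.commute)
      with that show False
        unfolding B_def by blast
    qed
    then have "E \<subseteq> space M - B"
      unfolding E_def by blast
    then have "prob E \<le> prob (space M - B)"
      using B by (intro finite_measure_mono sets.compl_sets)
    with prob_B show ?thesis
      by (simp only: prob_compl[OF B])
  qed
  have "(\<lambda>n. 1 - exp (- (lam * inverse (real (Suc n))))) \<longlonglongrightarrow> 1 - exp (- (lam * 0))"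
    by (intro tendsto_intros LIMSEQ_inverse_real_of_nat)
  moreover have "prob E \<le> 1 - exp (- (lam * inverse (real (Suc n))))" for n
    by (rule bound) (simp_all add: inverse_le_1_iff)
  ultimately have "prob E \<le> 0"
    by (intro LIMSEQ_le_const[of "\<lambda>n. 1 - exp (- (lam * inverse (real (Suc n))))"]) auto
  then have "prob E = 0"
    by (simp add: measure_le_0_iff)
  then have "AE \<omega> in M. \<omega> \<notin> E"
    using E_event prob_eq_0 by blast
  with AE_space show ?thesis
    by eventually_elim (simp add: E_def)
qed

end

section \<open>Short edges of a configuration\<close>

definition edge_upto :: "real set \<Rightarrow> real \<Rightarrow> bool" where
  "edge_upto \<phi> r \<longleftrightarrow> (\<exists>x\<in>\<phi> \<inter> {1..r}. \<exists>y\<in>\<phi> \<inter> {1..r}. x < y \<and> y - x \<le> 1)"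

lemma edge_upto_iff_gilbert_graph: "edge_upto \<phi> r \<longleftrightarrow> gilbert_graph (\<phi> \<inter> {1..r}) \<noteq> {}"
  unfolding gilbert_graph_eq_empty_iff edge_upto_def by blast

text \<open>
  The slack \<open>1 / (n + 1)\<close> leaves room for windows with rational end points, of which there are
  countably many. It creates no edge in the limit: the configuration has finitely many distances
  below \<open>r\<close>, and for large \<open>n\<close> none of them lies strictly between 1 and \<open>1 + 1 / (n + 1)\<close>.
\<close>

lemma edge_upto_iff_card:
  assumes \<phi>: "locally_finite_set \<phi>"
  shows "edge_upto \<phi> r \<longleftrightarrow>
    (\<forall>n. \<exists>q::rat. 2 \<le> card (\<phi> \<inter> ({of_rat q<..of_rat q + (1 + inverse (real (Suc n)))} \<inter> {1..r})))"
proof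
  assume "edge_upto \<phi> r"
  then obtain x y where xy: "x \<in> \<phi>" "y \<in> \<phi>" "x \<in> {1..r}" "y \<in> {1..r}" "x < y" "y - x \<le> 1"
    by (auto simp: edge_upto_def)
  show "\<forall>n. \<exists>q::rat. 2 \<le> card (\<phi> \<inter> ({of_rat q<..of_rat q + (1 + inverse (real (Suc n)))} \<inter> {1..r}))"
  proof
    fix n
    obtain q :: rat where q: "x - inverse (real (Suc n)) < of_rat q" "of_rat q < x"
      using of_rat_dense[of "x - inverse (real (Suc n))" x] by auto
    let ?W = "{of_rat q<..of_rat q + (1 + inverse (real (Suc n)))} \<inter> {1..r}"
    have "{x, y} \<subseteq> \<phi> \<inter> ?W"
      using xy q by auto
    moreover have "finite (\<phi> \<inter> ?W)"
      using \<phi> by (rule locally_finite_set_Int_bounded) (intro bounded_Int, simp)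
    ultimately have "card {x, y} \<le> card (\<phi> \<inter> ?W)"
      by (intro card_mono)
    with xy show "\<exists>q::rat. 2 \<le> card (\<phi> \<inter> ({of_rat q<..of_rat q + (1 + inverse (real (Suc n)))} \<inter> {1..r}))"
      by (intro exI[of _ q]) simp
  qed
next
  assume H: "\<forall>n. \<exists>q::rat. 2 \<le> card (\<phi> \<inter> ({of_rat q<..of_rat q + (1 + inverse (real (Suc n)))} \<inter> {1..r}))"
  show "edge_upto \<phi> r"
  proof (rule ccontr)
    assume no_edge: "\<not> edge_upto \<phi> r"
    define F where "F = \<phi> \<inter> {1..r}"
    have F: "finite F"
      unfolding F_def by (rule locally_finite_set_Int_bounded[OF \<phi>]) simp
    have lim: "(\<lambda>n. 1 + inverse (real (Suc n))) \<longlonglongrightarrow> 1"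
      using tendsto_add[OF tendsto_const LIMSEQ_inverse_real_of_nat, of 1] by simp
    have "\<forall>\<^sub>F n in sequentially. \<forall>p\<in>F \<times> F. fst p < snd p \<longrightarrow> 1 + inverse (real (Suc n)) < snd p - fst p"
    proof (rule eventually_ball_finite)
      show "\<forall>p\<in>F \<times> F. \<forall>\<^sub>F n in sequentially. fst p < snd p \<longrightarrow> 1 + inverse (real (Suc n)) < snd p - fst p"
      proof
        fix p assume p: "p \<in> F \<times> F"
        show "\<forall>\<^sub>F n in sequentially. fst p < snd p \<longrightarrow> 1 + inverse (real (Suc n)) < snd p - fst p"
        proof (cases "fst p < snd p")
          case True
          then have "1 < snd p - fst p"
            using p no_edge unfolding edge_upto_def F_def[symmetric] by (auto simp: not_le)
          from order_tendstoD(2)[OF lim this] show ?thesis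
            by eventually_elim simp
        qed simp
      qed
    qed (use F in simp)
    then obtain n where n: "\<And>x y. x \<in> F \<Longrightarrow> y \<in> F \<Longrightarrow> x < y \<Longrightarrow> 1 + inverse (real (Suc n)) < y - x"
      unfolding eventually_sequentially by (metis SigmaI fst_conv snd_conv order_refl)
    obtain q :: rat where q: "2 \<le> card (\<phi> \<inter> ({of_rat q<..of_rat q + (1 + inverse (real (Suc n)))} \<inter> {1..r}))"
      using H by blast
    let ?V = "\<phi> \<inter> ({of_rat q<..of_rat q + (1 + inverse (real (Suc n)))} \<inter> {1..r})"
    have fin: "finite ?V"
      using F by (rule finite_subset[rotated]) (auto simp: F_def)
    have "x = y" if "x \<in> ?V" "y \<in> ?V" for x y
    proof (cases x y rule: linorder_cases)
      case less
      with n[of x y] that show ?thesis by (auto simp: F_def)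
    next
      case greater
      with n[of y x] that show ?thesis by (auto simp: F_def)
    qed
    then have "card ?V \<le> 1"
      unfolding One_nat_def card_le_Suc0_iff_eq[OF fin] by blast
    with q show False by simp
  qed
qed

text \<open>
  Being a right-continuous function of \<open>r\<close>, the indicator is determined by rational arguments. This
  gives measurability when \<open>r\<close> is random.
\<close>

lemma edge_upto_rational:
  assumes \<phi>: "locally_finite_set \<phi>"
  shows "edge_upto \<phi> r \<longleftrightarrow> (\<forall>p::rat. r < of_rat p \<longrightarrow> edge_upto \<phi> (of_rat p))"
proof
  assume "edge_upto \<phi> r"
  then show "\<forall>p::rat. r < of_rat p \<longrightarrow> edge_upto \<phi> (of_rat p)"
    unfolding edge_upto_def by force
next
  assume H: "\<forall>p::rat. r < of_rat p \<longrightarrow> edge_upto \<phi> (of_rat p)"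
  have lim: "(\<lambda>n. r + inverse (real (Suc n))) \<longlonglongrightarrow> r"
    using tendsto_add[OF tendsto_const LIMSEQ_inverse_real_of_nat, of r] by simp
  have "\<forall>\<^sub>F n in sequentially. \<phi> \<inter> {0<..r + inverse (real (Suc n))} = \<phi> \<inter> {0<..r}"
    by (rule locally_finite_set_eventually_Ioc[OF \<phi> _ _ lim]) auto
  then obtain n where n: "\<phi> \<inter> {0<..r + inverse (real (Suc n))} = \<phi> \<inter> {0<..r}"
    unfolding eventually_sequentially by blast
  obtain p :: rat where p: "r < of_rat p" "of_rat p < r + inverse (real (Suc n))"
    using of_rat_dense[of r "r + inverse (real (Suc n))"] by auto
  have "x \<in> \<phi> \<inter> {1..r}" if "x \<in> \<phi> \<inter> {1..of_rat p}" for x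
  proof -
    have "x \<in> \<phi> \<inter> {0<..r + inverse (real (Suc n))}"
      using that p by auto
    with that show ?thesis
      unfolding n by auto
  qed
  with H p(1) show "edge_upto \<phi> r"
    unfolding edge_upto_def by blast
qed

lemma sets_edge_upto: "{\<phi> \<in> space config_space. edge_upto \<phi> r} \<in> sets config_space"
proof -
  have *: "{\<phi> \<in> space config_space. 2 \<le> card (\<phi> \<inter> ({a<..b} \<inter> {1..r}))} \<in> sets config_space" for a b
  proof -
    have "(\<lambda>\<phi>. card (\<phi> \<inter> ({a<..b} \<inter> {1..r}))) -` {2..} \<inter> space config_space \<in> sets config_space"
      by (intro measurable_sets[OF measurable_config_card] bounded_Int) auto
    then show ?thesis
      by (simp add: vimage_def Int_def conj_commute)
  qed
  have "{\<phi> \<in> space config_space. \<forall>n. \<exists>q::rat.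
      2 \<le> card (\<phi> \<inter> ({of_rat q<..of_rat q + (1 + inverse (real (Suc n)))} \<inter> {1..r}))} \<in> sets config_space"
    by (intro sets.sets_Collect_countable_All sets.sets_Collect_countable_Ex *)
  also have "{\<phi> \<in> space config_space. \<forall>n. \<exists>q::rat.
      2 \<le> card (\<phi> \<inter> ({of_rat q<..of_rat q + (1 + inverse (real (Suc n)))} \<inter> {1..r}))} =
      {\<phi> \<in> space config_space. edge_upto \<phi> r}"
    using edge_upto_iff_card by (auto simp only: space_config_space mem_Collect_eq)
  finally show ?thesis .
qed

section \<open>Conditioning on the initial segment and the future\<close>

lemma borel_measurable_of_bool:
  assumes "{\<omega> \<in> space M. P \<omega>} \<in> sets M"
  shows "(\<lambda>\<omega>. of_bool (P \<omega>) :: real) \<in> borel_measurable M"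
proof -
  have "(indicator {\<omega> \<in> space M. P \<omega>} :: _ \<Rightarrow> real) \<in> borel_measurable M"
    using assms by (rule borel_measurable_indicator)
  then show ?thesis
    by (rule measurable_cong[THEN iffD1, rotated]) (simp add: indicator_def)
qed

context poisson_line
begin

text \<open>
  The length of \<open>(t, t + 1] \<inter> (-\<infinity>, w]\<close>.
\<close>

definition window_length :: "real \<Rightarrow> real \<Rightarrow> real" where
  "window_length w t = min (max (w - t) 0) 1"

definition void_after :: "real \<Rightarrow> 'a \<Rightarrow> bool" where
  "void_after w \<omega> \<longleftrightarrow> pts \<omega> \<inter> {edge_end \<omega><..edge_end \<omega> + window_length w (edge_end \<omega>)} = {}"

lemma measurable_window_length: "(\<lambda>\<omega>. window_length w (edge_end \<omega>)) \<in> borel_measurable M"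
  using measurable_edge_end unfolding window_length_def by measurable

lemma sets_void_after: "{\<omega> \<in> space M. void_after w \<omega>} \<in> events"
proof -
  have "{\<omega> \<in> space M. \<not> (edge_end \<omega> < X (Suc i) \<omega> \<and> X (Suc i) \<omega> \<le> edge_end \<omega> + window_length w (edge_end \<omega>))} \<in> events" for i
  proof -
    have [measurable]: "X (Suc i) \<in> borel_measurable M"
      by (rule measurable_X) simp
    note [measurable] = measurable_edge_end measurable_window_length[of w]
    show ?thesis by measurable
  qed
  then have "{\<omega> \<in> space M. \<forall>i. \<not> (edge_end \<omega> < X (Suc i) \<omega> \<and> X (Suc i) \<omega> \<le> edge_end \<omega> + window_length w (edge_end \<omega>))} \<in> events"
    by (rule sets.sets_Collect_countable_All)
  moreover have "void_after w \<omega> \<longleftrightarrow> (\<forall>i. \<not> (edge_end \<omega> < X (Suc i) \<omega> \<and> X (Suc i) \<omega> \<le> edge_end \<omega> + window_length w (edge_end \<omega>)))" for \<omega>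
  proof -
    have pts: "pts \<omega> = range (\<lambda>i. X (Suc i) \<omega>)"
    proof safe
      fix y assume "y \<in> pts \<omega>"
      then obtain i where "y = X i \<omega>" "1 \<le> i"
        by (auto simp: pts_def point_set_def)
      then show "y \<in> range (\<lambda>i. X (Suc i) \<omega>)"
        by (cases i) auto
    qed (auto intro: X_in_pts)
    show ?thesis
      unfolding void_after_def disjoint_iff greaterThanAtMost_iff pts by blast
  qed
  ultimately show ?thesis by simp
qed

definition start_future :: "'a \<Rightarrow> real list \<times> real set" where
  "start_future \<omega> = (start \<omega>, future \<omega>)"

lemma measurable_start_future: "start_future \<in> measurable M (real_list_space \<Otimes>\<^sub>M config_space)"
  unfolding start_future_def using measurable_start measurable_future by (rule measurable_Pair)

text \<open>
  The future includes the point 1 whenever it is occupied, whereas the strong Markov property speaks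
  of half-open intervals starting at 1; this is harmless because 1 is almost surely vacant.
\<close>

lemma card_future_Int_Ioc:
  assumes "1 \<notin> future \<omega>"
  shows "card (future \<omega> \<inter> {a<..b}) = card (pts \<omega> \<inter> {edge_end \<omega> + max a 1<..edge_end \<omega> + b})"
proof -
  have "y \<noteq> 1" if "y \<in> future \<omega>" for y
    using assms that by blast
  then have "future \<omega> \<inter> {a<..b} = (\<lambda>y. y - edge_end \<omega>) ` (pts \<omega> \<inter> {edge_end \<omega> + max a 1<..edge_end \<omega> + b})"
    by (force simp: future_eq image_iff)
  then show ?thesis
    by (simp only:) (rule card_image, simp add: inj_on_def)
qed

text \<open>
  On products of an event for the initial segment and an interval cylinder for the future this is
  the strong Markov property; these products are stable under intersection and generate.
\<close>

lemma void_after_given_start_future: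
  assumes A: "A \<in> sets (real_list_space \<Otimes>\<^sub>M config_space)"
  shows "(\<integral>\<omega>. of_bool (start_future \<omega> \<in> A \<and> void_after w \<omega>) \<partial>M) =
    (\<integral>\<omega>. of_bool (start_future \<omega> \<in> A) * exp (- (lam * window_length w (edge_end \<omega>))) \<partial>M)"
proof -
  let ?P = "real_list_space \<Otimes>\<^sub>M config_space"
  define e where "e \<omega> = exp (- (lam * window_length w (edge_end \<omega>)))" for \<omega>
  define h where "h \<omega> = (of_bool (void_after w \<omega>) :: real)" for \<omega>
  have e_meas [measurable]: "e \<in> borel_measurable M"
    unfolding e_def using measurable_window_length[of w] by measurable
  have h_meas [measurable]: "h \<in> borel_measurable M"
    unfolding h_def by (rule borel_measurable_of_bool[OF sets_void_after])
  note sf [measurable] = measurable_start_future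
  have e_bounds: "0 \<le> e \<omega>" "e \<omega> \<le> 1" for \<omega>
    using lam_pos by (auto simp: e_def window_length_def)
  have h_bounds: "0 \<le> h \<omega>" "h \<omega> \<le> 1" for \<omega>
    by (auto simp: h_def)
  \<comment> \<open>The joint law of initial segment and future, weighted with the density \<open>p\<close>.\<close>
  define law where "law p = distr (density M (\<lambda>\<omega>. ennreal (p \<omega>))) ?P start_future" for p :: "'a \<Rightarrow> real"
  have law: "emeasure (law p) B = ennreal (\<integral>\<omega>. of_bool (start_future \<omega> \<in> B) * p \<omega> \<partial>M)"
    if B: "B \<in> sets ?P" and p [measurable]: "p \<in> borel_measurable M" and bounds: "\<And>\<omega>. 0 \<le> p \<omega>" "\<And>\<omega>. p \<omega> \<le> 1" for B p
  proof -
    have B': "start_future -` B \<inter> space M \<in> events"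
      by (rule measurable_sets[OF sf B])
    have "start_future \<in> measurable (density M (\<lambda>\<omega>. ennreal (p \<omega>))) ?P"
      using sf by (simp add: measurable_cong_sets[OF sets_density refl])
    then have "emeasure (law p) B = emeasure (density M (\<lambda>\<omega>. ennreal (p \<omega>))) (start_future -` B \<inter> space M)"
      unfolding law_def using B by (simp add: emeasure_distr)
    also have "\<dots> = (\<integral>\<^sup>+\<omega>. ennreal (p \<omega>) * indicator (start_future -` B \<inter> space M) \<omega> \<partial>M)"
      using B' by (intro emeasure_density) auto
    also have "\<dots> = (\<integral>\<^sup>+\<omega>. ennreal (indicator (start_future -` B \<inter> space M) \<omega> * p \<omega>) \<partial>M)"
      by (rule nn_integral_cong) (simp add: indicator_def)
    also have "\<dots> = ennreal (\<integral>\<omega>. indicator (start_future -` B \<inter> space M) \<omega> * p \<omega> \<partial>M)"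
    proof (rule nn_integral_eq_integral)
      show "integrable M (\<lambda>\<omega>. indicator (start_future -` B \<inter> space M) \<omega> * p \<omega>)"
      proof (rule integrable_const_bound[where B=1])
        show "AE \<omega> in M. norm (indicator (start_future -` B \<inter> space M) \<omega> * p \<omega>) \<le> 1"
          using bounds by (intro AE_I2) (simp add: indicator_def)
        show "(\<lambda>\<omega>. indicator (start_future -` B \<inter> space M) \<omega> * p \<omega>) \<in> borel_measurable M"
          using B' by (intro borel_measurable_times borel_measurable_indicator p)
      qed
      show "AE \<omega> in M. 0 \<le> indicator (start_future -` B \<inter> space M) \<omega> * p \<omega>"
        using bounds by (intro AE_I2) simp
    qed
    also have "(\<integral>\<omega>. indicator (start_future -` B \<inter> space M) \<omega> * p \<omega> \<partial>M) = (\<integral>\<omega>. of_bool (start_future \<omega> \<in> B) * p \<omega> \<partial>M)"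
      by (rule Bochner_Integration.integral_cong) (simp_all add: indicator_def)
    finally show ?thesis .
  qed
  define G where "G = {R \<times> C | R C. R \<in> sets real_list_space \<and> C \<in> interval_cylinders}"
  define S where "S = {\<phi>. locally_finite_set \<phi>}"
  have S_cyl: "S \<in> interval_cylinders"
    using interval_cylindersI[of 0] by (simp add: S_def)
  have UNIV_list: "UNIV \<in> sets real_list_space"
    using sets.top[of real_list_space] by (simp add: space_real_list_space)
  have cyl_sub: "interval_cylinders \<subseteq> Pow S"
    by (auto simp: interval_cylinders_def S_def)
  have G_Pow: "G \<subseteq> Pow (UNIV \<times> S)"
    using cyl_sub unfolding G_def by blast
  have G_sets: "sets ?P = sigma_sets (UNIV \<times> S) G"
  proof -
    have "sets ?P = sets (sigma (space real_list_space \<times> space config_space)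
        {a \<times> b | a b. a \<in> sets real_list_space \<and> b \<in> interval_cylinders})"
    proof (rule sets_pair_eq)
      show "sets real_list_space \<subseteq> Pow (space real_list_space)"
        by (rule sets.space_closed)
      show "sets real_list_space = sigma_sets (space real_list_space) (sets real_list_space)"
        by (rule sets.sigma_sets_eq[symmetric])
      show "countable {space real_list_space}" "{space real_list_space} \<subseteq> sets real_list_space"
        "\<Union> {space real_list_space} = space real_list_space"
        by auto
      show "interval_cylinders \<subseteq> Pow (space config_space)"
        using cyl_sub by (simp add: space_config_space S_def)
      show "sets config_space = sigma_sets (space config_space) interval_cylinders"
        using sets_config_space_eq_interval_cylinders by (simp add: space_config_space)
      show "countable {space config_space}" "{space config_space} \<subseteq> interval_cylinders"
        "\<Union> {space config_space} = space config_space"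
        using S_cyl by (auto simp: space_config_space S_def)
    qed
    then show ?thesis
      using G_Pow by (simp add: space_real_list_space space_config_space G_def S_def)
  qed
  have stable: "Int_stable G"
  proof (rule Int_stableI)
    fix B B' assume "B \<in> G" "B' \<in> G"
    then obtain R C R' C' where "B = R \<times> C" "R \<in> sets real_list_space" "C \<in> interval_cylinders"
      "B' = R' \<times> C'" "R' \<in> sets real_list_space" "C' \<in> interval_cylinders"
      unfolding G_def by blast
    then show "B \<inter> B' \<in> G"
      using Int_stable_interval_cylinders unfolding G_def Int_stable_def
      by (auto simp: Times_Int_Times intro!: sets.Int)
  qed
  have eq: "emeasure (law h) B = emeasure (law e) B" if "B \<in> G" for B
  proof -
    obtain R m and a b :: "nat \<Rightarrow> real" and k where R: "R \<in> sets real_list_space" and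
      B: "B = R \<times> {\<phi>. locally_finite_set \<phi> \<and> (\<forall>j<m::nat. card (\<phi> \<inter> {a j<..b j}) = k j)}"
      using \<open>B \<in> G\<close> unfolding G_def interval_cylinders_def by blast
    have B_sets: "B \<in> sets ?P"
      using \<open>B \<in> G\<close> unfolding G_sets by (rule sigma_sets.Basic)
    \<comment> \<open>The event of \<open>B\<close> in terms of counts in half-open intervals beyond distance 1.\<close>
    define D where "D \<omega> \<longleftrightarrow> start \<omega> \<in> R \<and> start \<omega> \<noteq> [] \<and>
      (\<forall>j<m. card (pts \<omega> \<inter> {edge_end \<omega> + max (a j) 1<..edge_end \<omega> + b j}) = k j)" for \<omega>
    have D: "AE \<omega> in M. start_future \<omega> \<in> B \<longleftrightarrow> D \<omega>"
      using AE_space AE_start_nonempty AE_one_notin_future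
    proof eventually_elim
      case (elim \<omega>)
      then show ?case
        using locally_finite_future[OF elim(1)]
        unfolding B D_def start_future_def by (simp add: card_future_Int_Ioc)
    qed
    note sm = strong_markov_void[OF R, where m=m and a="\<lambda>j. max (a j) 1" and b=b and k=k, folded D_def]
    have v: "t \<le> t + window_length w t" "t + window_length w t \<le> t + 1" "mono (\<lambda>t. t + window_length w t)"
      "continuous_on UNIV (\<lambda>t. t + window_length w t)" for t
      by (auto simp: mono_def window_length_def intro!: continuous_intros)
    have id: "mono (\<lambda>t::real. t)" "continuous_on UNIV (\<lambda>t::real. t)"
      by (auto simp: mono_def)
    have DV_event: "{\<omega> \<in> space M. D \<omega> \<and> void_after w \<omega>} \<in> events"
      unfolding void_after_def by (rule sm(2)[where u="\<lambda>t. t" and v="\<lambda>t. t + window_length w t"]) (use v id in simp_all)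
    have DV_integral: "(\<integral>\<omega>. of_bool (D \<omega> \<and> void_after w \<omega>) \<partial>M) = (\<integral>\<omega>. of_bool (D \<omega>) * e \<omega> \<partial>M)"
    proof -
      have "(\<integral>\<omega>. of_bool (D \<omega> \<and> pts \<omega> \<inter> {edge_end \<omega><..edge_end \<omega> + window_length w (edge_end \<omega>)} = {}) \<partial>M) =
          (\<integral>\<omega>. of_bool (D \<omega>) * exp (- (lam * (edge_end \<omega> + window_length w (edge_end \<omega>) - edge_end \<omega>))) \<partial>M)"
        by (rule sm(1)[where u="\<lambda>t. t" and v="\<lambda>t. t + window_length w t"]) (use v id in simp_all)
      then show ?thesis
        unfolding void_after_def e_def by simp
    qed
    \<comment> \<open>The instance with empty intervals gives that \<open>D\<close> itself is an event.\<close>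
    have "{\<omega> \<in> space M. D \<omega> \<and> pts \<omega> \<inter> {edge_end \<omega><..edge_end \<omega>} = {}} \<in> events"
      by (rule sm(2)[where u="\<lambda>t. t" and v="\<lambda>t. t"]) (use id in simp_all)
    then have D_event: "{\<omega> \<in> space M. D \<omega>} \<in> events"
      by simp
    have B_event: "{\<omega> \<in> space M. start_future \<omega> \<in> B} \<in> events"
      using measurable_sets[OF sf B_sets] by (simp add: vimage_def Int_def conj_commute)
    have "(\<integral>\<omega>. of_bool (start_future \<omega> \<in> B) * h \<omega> \<partial>M) = (\<integral>\<omega>. of_bool (D \<omega> \<and> void_after w \<omega>) \<partial>M)"
    proof (rule integral_cong_AE)
      show "AE \<omega> in M. of_bool (start_future \<omega> \<in> B) * h \<omega> = of_bool (D \<omega> \<and> void_after w \<omega>)"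
        using D by eventually_elim (simp add: h_def)
    qed (intro borel_measurable_times borel_measurable_of_bool B_event DV_event h_meas)+
    also have "\<dots> = (\<integral>\<omega>. of_bool (D \<omega>) * e \<omega> \<partial>M)"
      by (rule DV_integral)
    also have "\<dots> = (\<integral>\<omega>. of_bool (start_future \<omega> \<in> B) * e \<omega> \<partial>M)"
    proof (rule integral_cong_AE)
      show "AE \<omega> in M. of_bool (D \<omega>) * e \<omega> = of_bool (start_future \<omega> \<in> B) * e \<omega>"
        using D by eventually_elim simp
    qed (intro borel_measurable_times borel_measurable_of_bool B_event D_event e_meas)+
    finally have "(\<integral>\<omega>. of_bool (start_future \<omega> \<in> B) * h \<omega> \<partial>M) = (\<integral>\<omega>. of_bool (start_future \<omega> \<in> B) * e \<omega> \<partial>M)" .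
    then show ?thesis
      by (simp only: law[OF B_sets h_meas h_bounds] law[OF B_sets e_meas e_bounds])
  qed
  have "law h = law e"
  proof (rule measure_eqI_generator_eq[OF stable G_Pow eq, where A="\<lambda>_. UNIV \<times> S"])
    show "range (\<lambda>_::nat. UNIV \<times> S) \<subseteq> G"
      using UNIV_list S_cyl unfolding G_def by blast
    have "UNIV \<times> S \<in> sets ?P"
      unfolding G_sets by (rule sigma_sets_top)
    from law[OF this h_meas h_bounds] show "emeasure (law h) (UNIV \<times> S) \<noteq> \<infinity>"
      by simp
  qed (simp_all add: law_def G_sets)
  then have "ennreal (\<integral>\<omega>. of_bool (start_future \<omega> \<in> A) * h \<omega> \<partial>M) = ennreal (\<integral>\<omega>. of_bool (start_future \<omega> \<in> A) * e \<omega> \<partial>M)"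
    using law[OF A h_meas h_bounds] law[OF A e_meas e_bounds] by simp
  moreover have "0 \<le> (\<integral>\<omega>. of_bool (start_future \<omega> \<in> A) * h \<omega> \<partial>M)" "0 \<le> (\<integral>\<omega>. of_bool (start_future \<omega> \<in> A) * e \<omega> \<partial>M)"
    using h_bounds e_bounds by (auto intro!: integral_nonneg_AE)
  ultimately show ?thesis
    unfolding h_def e_def by (simp add: of_bool_conj)
qed

end

section \<open>The conditional probability of at most one edge\<close>

context poisson_line
begin

lemma F_plus_eq_vimage_algebra: "F_plus M X = vimage_algebra (space M) start_future (real_list_space \<Otimes>\<^sub>M config_space)"
  unfolding F_plus_def start_future_def ..

lemma start_future_in_space: "start_future \<in> space M \<rightarrow> space (real_list_space \<Otimes>\<^sub>M config_space)"
  using measurable_space[OF measurable_start_future] by auto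

lemma space_F_plus [simp]: "space (F_plus M X) = space M"
  by (simp add: F_plus_eq_vimage_algebra)

lemma sets_F_plus: "sets (F_plus M X) =
    {start_future -` B \<inter> space M | B. B \<in> sets (real_list_space \<Otimes>\<^sub>M config_space)}"
  unfolding F_plus_eq_vimage_algebra by (rule sets_vimage_algebra2[OF start_future_in_space])

lemma subalgebra_F_plus: "subalgebra M (F_plus M X)"
  unfolding subalgebra_def sets_F_plus
  using measurable_sets[OF measurable_start_future] by auto

lemma measurable_start_future_F_plus:
  "start_future \<in> measurable (F_plus M X) (real_list_space \<Otimes>\<^sub>M config_space)"
  unfolding F_plus_eq_vimage_algebra by (rule measurable_vimage_algebra1[OF start_future_in_space])

lemma measurable_edge_end_F_plus: "edge_end \<in> borel_measurable (F_plus M X)"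
proof -
  have "(\<lambda>\<omega>. fst (start_future \<omega>)) \<in> measurable (F_plus M X) real_list_space"
    by (rule measurable_compose[OF measurable_start_future_F_plus measurable_fst])
  from measurable_compose[OF this measurable_last_real_list_space[of 0]] show ?thesis
    unfolding edge_end_eq_last[abs_def] start_future_def fst_conv .
qed

lemma measurable_future_F_plus: "future \<in> measurable (F_plus M X) config_space"
  using measurable_compose[OF measurable_start_future_F_plus measurable_snd]
  by (simp add: start_future_def)

lemma sets_edge_upto_F_plus: "{\<omega> \<in> space M. edge_upto (future \<omega>) (w - edge_end \<omega>)} \<in> sets (F_plus M X)"
proof -
  have "{\<omega> \<in> space (F_plus M X). w - edge_end \<omega> < of_rat p \<longrightarrow> edge_upto (future \<omega>) (of_rat p)} \<in> sets (F_plus M X)" for p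
  proof (rule sets.sets_Collect_imp)
    note [measurable] = measurable_edge_end_F_plus
    show "{\<omega> \<in> space (F_plus M X). w - edge_end \<omega> < of_rat p} \<in> sets (F_plus M X)"
      by measurable
    have "future -` {\<phi> \<in> space config_space. edge_upto \<phi> (of_rat p)} \<inter> space (F_plus M X) \<in> sets (F_plus M X)"
      by (rule measurable_sets[OF measurable_future_F_plus sets_edge_upto])
    also have "future -` {\<phi> \<in> space config_space. edge_upto \<phi> (of_rat p)} \<inter> space (F_plus M X) =
        {\<omega> \<in> space (F_plus M X). edge_upto (future \<omega>) (of_rat p)}"
      using measurable_space[OF measurable_future] by auto
    finally show "{\<omega> \<in> space (F_plus M X). edge_upto (future \<omega>) (of_rat p)} \<in> sets (F_plus M X)" .
  qed
  then have "{\<omega> \<in> space (F_plus M X). \<forall>p::rat. w - edge_end \<omega> < of_rat p \<longrightarrow> edge_upto (future \<omega>) (of_rat p)} \<in> sets (F_plus M X)"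
    by (rule sets.sets_Collect_countable_All)
  also have "{\<omega> \<in> space (F_plus M X). \<forall>p::rat. w - edge_end \<omega> < of_rat p \<longrightarrow> edge_upto (future \<omega>) (of_rat p)} =
      {\<omega> \<in> space M. edge_upto (future \<omega>) (w - edge_end \<omega>)}"
    unfolding space_F_plus using edge_upto_rational[OF locally_finite_future, symmetric] by (intro Collect_cong conj_cong refl)
  finally show ?thesis .
qed

lemma at_most_one_edge_iff_void_after:
  assumes \<omega>: "\<omega> \<in> space M" and ne: "start \<omega> \<noteq> []"
  shows "card (gilbert_graph (pts \<omega> \<inter> {0..w})) \<le> 1 \<longleftrightarrow>
    void_after w \<omega> \<and> \<not> edge_upto (future \<omega>) (w - edge_end \<omega>)"
proof -
  obtain n where n: "I_plus (\<lambda>i. X i \<omega>) = enat n"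
    using ne initial_points_Nil_iff by (cases "I_plus (\<lambda>i. X i \<omega>)") blast+
  show ?thesis
    using at_most_one_edge_iff[OF X_strict_mono[OF \<omega>] locally_finite_pts[OF \<omega>, unfolded pts_def]
        pts_nonneg[OF \<omega>, unfolded pts_def] n, of w]
    unfolding void_after_def window_length_def edge_upto_iff_gilbert_graph pts_def by blast
qed

lemma no_edge_of_start_Nil:
  assumes \<omega>: "\<omega> \<in> space M" and Nil: "start \<omega> = []"
  shows "gilbert_graph (pts \<omega> \<inter> {0..w}) = {}"
  unfolding gilbert_graph_eq_empty_iff
proof safe
  fix p q assume pq: "p \<in> pts \<omega>" "q \<in> pts \<omega>" "p < q" "q - p \<le> 1"
  then obtain i j where ij: "p = X i \<omega>" "q = X j \<omega>" "1 \<le> i" "1 \<le> j"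
    by (auto simp: pts_def point_set_def)
  have "i < j"
    using X_less_iff[OF \<omega> ij(3,4)] pq(3) ij by simp
  then have "1 \<le> j - 1" "i \<le> j - 1" "2 \<le> j"
    using ij by linarith+
  moreover have "X j \<omega> - X (j - 1) \<omega> > 1"
    using Nil \<open>2 \<le> j\<close> by (simp add: initial_points_Nil_iff I_plus_eq_infinity_iff)
  ultimately show False
    using X_le_iff[OF \<omega> ij(3), of "j - 1"] pq(4) ij by linarith
qed

text \<open>
  If there is no short gap at all, there is no edge, so the event is described by measurable
  conditions on the whole space and not only up to a null set.
\<close>

lemma sets_at_most_one_edge: "{\<omega> \<in> space M. card (gilbert_graph (pts \<omega> \<inter> {0..w})) \<le> 1} \<in> events"
proof -
  have Nil: "{\<omega> \<in> space M. start \<omega> = []} \<in> events"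
    using measurable_sets[OF measurable_start Nil_in_real_list_space] by (simp add: vimage_def Int_def conj_commute)
  have edge: "{\<omega> \<in> space M. edge_upto (future \<omega>) (w - edge_end \<omega>)} \<in> events"
    using sets_edge_upto_F_plus subalgebra_F_plus unfolding subalgebra_def by blast
  have "{\<omega> \<in> space M. start \<omega> = []} \<union> ({\<omega> \<in> space M. void_after w \<omega>} -
      {\<omega> \<in> space M. edge_upto (future \<omega>) (w - edge_end \<omega>)}) \<inter> (space M - {\<omega> \<in> space M. start \<omega> = []}) \<in> events"
    by (intro sets.Un sets.Int sets.Diff sets.compl_sets Nil edge sets_void_after)
  also have "{\<omega> \<in> space M. start \<omega> = []} \<union> ({\<omega> \<in> space M. void_after w \<omega>} -
      {\<omega> \<in> space M. edge_upto (future \<omega>) (w - edge_end \<omega>)}) \<inter> (space M - {\<omega> \<in> space M. start \<omega> = []}) =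
      {\<omega> \<in> space M. card (gilbert_graph (pts \<omega> \<inter> {0..w})) \<le> 1}"
  proof (rule set_eqI)
    fix \<omega>
    show "\<omega> \<in> {\<omega> \<in> space M. start \<omega> = []} \<union> ({\<omega> \<in> space M. void_after w \<omega>} -
      {\<omega> \<in> space M. edge_upto (future \<omega>) (w - edge_end \<omega>)}) \<inter> (space M - {\<omega> \<in> space M. start \<omega> = []}) \<longleftrightarrow>
      \<omega> \<in> {\<omega> \<in> space M. card (gilbert_graph (pts \<omega> \<inter> {0..w})) \<le> 1}"
    proof (cases "\<omega> \<in> space M \<and> start \<omega> \<noteq> []")
      case True
      then show ?thesis
        using at_most_one_edge_iff_void_after[of \<omega> w] by blast
    next
      case False
      then show ?thesis
        using no_edge_of_start_Nil[of \<omega> w] by (cases "\<omega> \<in> space M") simp_all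
    qed
  qed
  finally show ?thesis .
qed

text \<open>
  For \<open>A\<close> in \<open>F_plus\<close>, the part of the edge event that is known given \<open>F_plus\<close>, namely \<open>Q\<close>, is moved
  into \<open>A\<close>. What remains is the void event after the end of the first short gap.
\<close>

lemma cond_prob_at_most_one_edge:
  "AE \<omega> in M. real_cond_exp M (F_plus M X)
      (indicator {\<omega> \<in> space M. card (gilbert_graph (pts \<omega> \<inter> {0..w})) \<le> 1}) \<omega> =
    exp (- (lam * window_length w (edge_end \<omega>))) * of_bool (\<not> edge_upto (future \<omega>) (w - edge_end \<omega>))"
proof -
  let ?F = "F_plus M X"
  let ?E = "{\<omega> \<in> space M. card (gilbert_graph (pts \<omega> \<inter> {0..w})) \<le> 1}"
  define e where "e \<omega> = exp (- (lam * window_length w (edge_end \<omega>)))" for \<omega>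
  define Q where "Q = {\<omega> \<in> space M. \<not> edge_upto (future \<omega>) (w - edge_end \<omega>)}"
  have sub: "subalgebra M ?F"
    by (rule subalgebra_F_plus)
  interpret F: finite_measure_subalgebra M ?F
    by unfold_locales (rule sub)
  have Q: "Q \<in> sets ?F"
  proof -
    have "Q = space ?F - {\<omega> \<in> space M. edge_upto (future \<omega>) (w - edge_end \<omega>)}"
      by (auto simp: Q_def)
    then show ?thesis
      using sets.compl_sets[OF sets_edge_upto_F_plus] by simp
  qed
  have e_F: "e \<in> borel_measurable ?F"
    using measurable_edge_end_F_plus unfolding e_def window_length_def by measurable
  have g_F: "(\<lambda>\<omega>. e \<omega> * indicator Q \<omega>) \<in> borel_measurable ?F"
    using e_F Q by (intro borel_measurable_times borel_measurable_indicator)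
  have e_bounds: "0 \<le> e \<omega>" "e \<omega> \<le> 1" for \<omega>
    using lam_pos by (auto simp: e_def window_length_def)
  have "AE \<omega> in M. real_cond_exp M ?F (indicator ?E) \<omega> = e \<omega> * indicator Q \<omega>"
  proof (rule F.real_cond_exp_charact)
    show "integrable M (indicator ?E :: _ \<Rightarrow> real)"
      using sets_at_most_one_edge by (intro integrable_real_indicator) (simp_all add: emeasure_eq_measure)
    show "integrable M (\<lambda>\<omega>. e \<omega> * indicator Q \<omega>)"
    proof (rule integrable_const_bound[where B=1])
      show "AE \<omega> in M. norm (e \<omega> * indicator Q \<omega>) \<le> 1"
        using e_bounds by (intro AE_I2) (simp add: indicator_def)
      show "(\<lambda>\<omega>. e \<omega> * indicator Q \<omega>) \<in> borel_measurable M"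
        by (rule measurable_from_subalg[OF sub g_F])
    qed
    show "(\<lambda>\<omega>. e \<omega> * indicator Q \<omega>) \<in> borel_measurable ?F"
      by (rule g_F)
    fix A assume A: "A \<in> sets ?F"
    then have A_M: "A \<in> events"
      using sub unfolding subalgebra_def by blast
    have "A \<inter> Q \<in> sets ?F"
      using A Q by (rule sets.Int)
    then obtain B where B: "B \<in> sets (real_list_space \<Otimes>\<^sub>M config_space)" and AQ: "A \<inter> Q = start_future -` B \<inter> space M"
      unfolding sets_F_plus by blast
    have AQ_iff: "start_future \<omega> \<in> B \<longleftrightarrow> \<omega> \<in> A \<and> \<omega> \<in> Q" if "\<omega> \<in> space M" for \<omega>
      using AQ that by blast
    have B_event: "{\<omega> \<in> space M. start_future \<omega> \<in> B} \<in> events"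
      using measurable_sets[OF measurable_start_future B] by (simp add: vimage_def Int_def conj_commute)
    have BV_event: "{\<omega> \<in> space M. start_future \<omega> \<in> B \<and> void_after w \<omega>} \<in> events"
      by (intro sets.sets_Collect_conj B_event sets_void_after)
    have "(\<integral>\<omega>\<in>A. (indicator ?E \<omega> :: real) \<partial>M) = (\<integral>\<omega>. (indicator A \<omega> * indicator ?E \<omega> :: real) \<partial>M)"
      by (simp add: set_lebesgue_integral_def)
    also have "\<dots> = (\<integral>\<omega>. of_bool (start_future \<omega> \<in> B \<and> void_after w \<omega>) \<partial>M)"
    proof (rule integral_cong_AE)
      show "AE \<omega> in M. indicator A \<omega> * indicator ?E \<omega> = (of_bool (start_future \<omega> \<in> B \<and> void_after w \<omega>) :: real)"
        using AE_space AE_start_nonempty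
      proof eventually_elim
        case (elim \<omega>)
        have "\<omega> \<in> ?E \<longleftrightarrow> void_after w \<omega> \<and> \<omega> \<in> Q"
          using at_most_one_edge_iff_void_after[OF elim, of w] elim(1) by (simp only: Q_def mem_Collect_eq simp_thms)
        then show ?case
          unfolding indicator_def AQ_iff[OF elim(1)] by auto
      qed
      show "(\<lambda>\<omega>. indicator A \<omega> * indicator ?E \<omega> :: real) \<in> borel_measurable M"
        using A_M sets_at_most_one_edge by (intro borel_measurable_times borel_measurable_indicator)
      show "(\<lambda>\<omega>. of_bool (start_future \<omega> \<in> B \<and> void_after w \<omega>) :: real) \<in> borel_measurable M"
        by (rule borel_measurable_of_bool[OF BV_event])
    qed
    also have "\<dots> = (\<integral>\<omega>. of_bool (start_future \<omega> \<in> B) * e \<omega> \<partial>M)"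
      unfolding e_def by (rule void_after_given_start_future[OF B])
    also have "\<dots> = (\<integral>\<omega>\<in>A. e \<omega> * indicator Q \<omega> \<partial>M)"
      unfolding set_lebesgue_integral_def
      by (rule Bochner_Integration.integral_cong) (simp_all add: AQ_iff indicator_def)
    finally show "(\<integral>\<omega>\<in>A. (indicator ?E \<omega> :: real) \<partial>M) = (\<integral>\<omega>\<in>A. e \<omega> * indicator Q \<omega> \<partial>M)" .
  qed
  with AE_space show ?thesis
    by eventually_elim (simp add: e_def Q_def indicator_def)
qed

end

theorem theorem3:
  fixes M :: "'a measure" and X :: "nat \<Rightarrow> 'a \<Rightarrow> real" and lam w :: real
  assumes "prob_space M"
    and "lam > 0"
    and "homogeneous_poisson_process M lam {0..} (\<lambda>\<omega>. point_set (\<lambda>i. X i \<omega>))"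
    and "\<And>\<omega>. \<omega> \<in> space M \<Longrightarrow> strict_mono_on {1..} (\<lambda>i. X i \<omega>)"
    and "w \<ge> 1"
  shows "AE \<omega> in M.
    real_cond_exp M (F_plus M X)
      (indicator {\<omega> \<in> space M. card (gilbert_graph (point_set (\<lambda>i. X i \<omega>) \<inter> {0..w})) \<le> 1}) \<omega> =
    exp (- lam * min (max (w - x_I_plus (\<lambda>i. X i \<omega>)) 0) 1) *
    of_bool (gilbert_graph (X_plus (\<lambda>i. X i \<omega>) \<inter> {1..w - x_I_plus (\<lambda>i. X i \<omega>)}) = {})"
proof -
  interpret prob_space M by fact
  interpret poisson_line M X lam
    by unfold_locales (use assms in auto)
  show ?thesis
    using cond_prob_at_most_one_edge[of w]
    by (simp add: pts_def window_length_def edge_upto_iff_gilbert_graph)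
qed

end
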